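(* Let $\mathcal{A}$ be a bottom-up tree automaton over $\mathcal{B}(t)$. Then one can construct in time $2^{O(t)}\cdot|\mathcal{A}|$ a bottom-up tree automaton $\mathrm{Sub}(\mathcal{A})$ over $\mathcal{B}(t)$ such that $$\mathcal{L}(\mathrm{Sub}(\mathcal{A}))=\{\mathbf{T}\in\mathit{Ter}(\mathcal{B}(t))\mid \exists\,\mathbf{T}'\in\mathcal{L}(\mathcal{A})\text{ such that }\mathbf{T}\text{ is a sub-decomposition of }\mathbf{T}'\}.$$
   Context: Terms: for a finite alphabet $\Sigma$, $\mathit{Ter}(\Sigma)$ is the smallest set with $a$, $a(t_1)$, $a(t_1,t_2)\in\mathit{Ter}(\Sigma)$ for $a\in\Sigma$, $t_i\in\mathit{Ter}(\Sigma)$. Positions: $\mathit{Pos}(a(t_1,\dots,t_r))=\{\lambda\}\cup\bigcup_{j\le r}\{jp\mid p\in\mathit{Pos}(t_j)\}$; $pj$ is a child of $p$; $t[p]$ is the symbol at $p$. Tree automata: a bottom-up tree automaton over $\Sigma$ is $(Q,\Sigma,F,\Delta)$ with states $Q$, final states $F$, and transitions $(q_1,\dots,q_r,a,q)$, $0\le r\le2$. A term $a(t_1,\dots,t_r)$ reaches $q$ if some transition $(q_1,\dots,q_r,a,q)$ exists with each $t_j$ reaching $q_j$; $\mathcal{L}(\mathcal{A})$ is the set of terms reaching a final state. $|\mathcal{A}|=|Q|+|\Delta|$. A $t$-concrete bag is a pair $(B,b)$ with $B\subseteq\{1,\dots,t\}$, $b\subseteq B$, $b=\emptyset$ or $|b|=2$;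 $\mathcal{B}(t)$ is the set of them. For $\mathbf{T}\in\mathit{Ter}(\mathcal{B}(t))$ write $\mathbf{T}[p]=(\mathbf{T}[p].B,\mathbf{T}[p].b)$. $(B,b)$ is a sub-bag of $(B',b')$ if $B\subseteq B'$ and $b\subseteq b'$. $\mathbf{T}$ is a sub-decomposition of $\mathbf{T}'$ if (S1) $\mathit{Pos}(\mathbf{T})=\mathit{Pos}(\mathbf{T}')$; (S2) for each $p$, $\mathbf{T}[p]$ is a sub-bag of $\mathbf{T}'[p]$; (S3) for all positions $p,pj$ and $s\in[t]$, if $s\in\mathbf{T}'[p].B$ and $s\in\mathbf{T}'[pj].B$ then $s\notin\mathbf{T}[p].B$ iff $s\notin\mathbf{T}[pj].B$. *)

theory Defs
  imports Complex_Main "HOL-Library.Landau_Symbols"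
begin

section \<open>Terms, positions and bottom-up tree automata\<close>

datatype 'a trm = Nullary 'a | Unary 'a "'a trm" | Binary 'a "'a trm" "'a trm"

inductive_set Ter :: "'a set \<Rightarrow> 'a trm set" for \<Sigma> :: "'a set" where
  "a \<in> \<Sigma> \<Longrightarrow> Nullary a \<in> Ter \<Sigma>"
| "a \<in> \<Sigma> \<Longrightarrow> t1 \<in> Ter \<Sigma> \<Longrightarrow> Unary a t1 \<in> Ter \<Sigma>"
| "a \<in> \<Sigma> \<Longrightarrow> t1 \<in> Ter \<Sigma> \<Longrightarrow> t2 \<in> Ter \<Sigma> \<Longrightarrow> Binary a t1 t2 \<in> Ter \<Sigma>"

fun Pos :: "'a trm \<Rightarrow> nat list set" where
  "Pos (Nullary a) = {[]}"
| "Pos (Unary a t1) = {[]} \<union> (#) 1 ` Pos t1"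
| "Pos (Binary a t1 t2) = {[]} \<union> (#) 1 ` Pos t1 \<union> (#) 2 ` Pos t2"

fun root :: "'a trm \<Rightarrow> 'a" where
  "root (Nullary a) = a"
| "root (Unary a t1) = a"
| "root (Binary a t1 t2) = a"

fun args :: "'a trm \<Rightarrow> 'a trm list" where
  "args (Nullary a) = []"
| "args (Unary a t1) = [t1]"
| "args (Binary a t1 t2) = [t1, t2]"

text \<open>The symbol at a position; only meaningful for positions in \<^term>\<open>Pos T\<close>.\<close>
fun symbol_at :: "'a trm \<Rightarrow> nat list \<Rightarrow> 'a" where
  "symbol_at T [] = root T"
| "symbol_at T (j # p) = symbol_at (args T ! (j - 1)) p"

record ('q, 'a) ta =
  states :: "'q set"
  final :: "'q set"
  trans :: "('q list \<times> 'a \<times> 'q) set"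

definition tree_automaton :: "'a set \<Rightarrow> ('q, 'a) ta \<Rightarrow> bool" where
  "tree_automaton \<Sigma> A \<longleftrightarrow>
     finite (states A) \<and> final A \<subseteq> states A \<and> finite (trans A) \<and>
     (\<forall>(qs, a, q) \<in> trans A.
        length qs \<le> 2 \<and> set qs \<subseteq> states A \<and> a \<in> \<Sigma> \<and> q \<in> states A)"

inductive reaches :: "('q, 'a) ta \<Rightarrow> 'a trm \<Rightarrow> 'q \<Rightarrow> bool" for A where
  "([], a, q) \<in> trans A \<Longrightarrow> reaches A (Nullary a) q"
| "([q1], a, q) \<in> trans A \<Longrightarrow> reaches A t1 q1 \<Longrightarrow> reaches A (Unary a t1) q"
| "([q1, q2], a, q) \<in> trans A \<Longrightarrow> reaches A t1 q1 \<Longrightarrow> reaches A t2 q2 \<Longrightarrow>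
     reaches A (Binary a t1 t2) q"

definition lang :: "('q, 'a) ta \<Rightarrow> 'a trm set" where
  "lang A = {T. \<exists>q \<in> final A. reaches A T q}"

definition ta_size :: "('q, 'a) ta \<Rightarrow> nat" where
  "ta_size A = card (states A) + card (trans A)"

section \<open>Concrete bags and sub-decompositions\<close>

type_synonym bag = "nat set \<times> nat set"

definition concrete_bags :: "nat \<Rightarrow> bag set" where
  "concrete_bags t = {(B, b). B \<subseteq> {1..t} \<and> b \<subseteq> B \<and> (b = {} \<or> card b = 2)}"

definition sub_bag :: "bag \<Rightarrow> bag \<Rightarrow> bool" where
  "sub_bag x y \<longleftrightarrow> fst x \<subseteq> fst y \<and> snd x \<subseteq> snd y"

definition sub_decomposition :: "nat \<Rightarrow> bag trm \<Rightarrow> bag trm \<Rightarrow> bool" where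
  "sub_decomposition t T T' \<longleftrightarrow>
     Pos T = Pos T' \<and>
     (\<forall>p \<in> Pos T. sub_bag (symbol_at T p) (symbol_at T' p)) \<and>
     (\<forall>p j. p \<in> Pos T \<longrightarrow> p @ [j] \<in> Pos T \<longrightarrow>
        (\<forall>s \<in> {1..t}.
           s \<in> fst (symbol_at T' p) \<longrightarrow> s \<in> fst (symbol_at T' (p @ [j])) \<longrightarrow>
           (s \<notin> fst (symbol_at T p) \<longleftrightarrow> s \<notin> fst (symbol_at T (p @ [j])))))"

section \<open>Running time\<close>

text \<open>
  Running time is measured on a unit-cost random access machine with structured control flow.
  A configuration consists of registers and of an addressable memory, both holding natural
  numbers.  The arithmetic is addition and truncated subtraction only; every elementary
  statement and every test of a register against zero takes one step.
\<close>

datatype ram =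
    Const nat nat
  | Add nat nat nat
  | Sub nat nat nat
  | Load nat nat
  | Store nat nat
  | Seq ram ram
  | If nat ram ram
  | While nat ram

record config =
  reg :: "nat \<Rightarrow> nat"
  mem :: "nat \<Rightarrow> nat"

inductive exec :: "ram \<Rightarrow> config \<Rightarrow> nat \<Rightarrow> config \<Rightarrow> bool" where
  Const: "exec (Const x n) s 1 (s\<lparr>reg := (reg s)(x := n)\<rparr>)"
| Add: "exec (Add x y z) s 1 (s\<lparr>reg := (reg s)(x := reg s y + reg s z)\<rparr>)"
| Sub: "exec (Sub x y z) s 1 (s\<lparr>reg := (reg s)(x := reg s y - reg s z)\<rparr>)"
| Load: "exec (Load x y) s 1 (s\<lparr>reg := (reg s)(x := mem s (reg s y))\<rparr>)"
| Store: "exec (Store x y) s 1 (s\<lparr>mem := (mem s)(reg s x := reg s y)\<rparr>)"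
| Seq: "exec c s m s' \<Longrightarrow> exec d s' n s'' \<Longrightarrow> exec (Seq c d) s (m + n) s''"
| IfTrue: "reg s x \<noteq> 0 \<Longrightarrow> exec c s n s' \<Longrightarrow> exec (If x c d) s (Suc n) s'"
| IfFalse: "reg s x = 0 \<Longrightarrow> exec d s n s' \<Longrightarrow> exec (If x c d) s (Suc n) s'"
| WhileFalse: "reg s x = 0 \<Longrightarrow> exec (While x c) s 1 s"
| WhileTrue: "reg s x \<noteq> 0 \<Longrightarrow> exec c s m s' \<Longrightarrow> exec (While x c) s' n s'' \<Longrightarrow>
    exec (While x c) s (Suc (m + n)) s''"

inductive_cases exec_elims:
  "exec (Const x k) s n s'" "exec (Add x y z) s n s'" "exec (Sub x y z) s n s'"
  "exec (Load x y) s n s'" "exec (Store x y) s n s'" "exec (Seq c d) s n s'"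
  "exec (If x c d) s n s'" "exec (While x c) s n s'"

lemma exec_deterministic:
  "exec c s m s' \<Longrightarrow> exec c s n s'' \<Longrightarrow> n = m \<and> s'' = s'"
proof (induction arbitrary: n s'' rule: exec.induct)
  case (Seq c s m s' d k s1)
  from Seq.prems obtain m1 r k1 where "n = m1 + k1" "exec c s m1 r" "exec d r k1 s''"
    by (rule exec_elims(6))
  with Seq.IH(1)[of m1 r] Seq.IH(2)[of k1 s''] show ?case by simp
next
  case (IfTrue s x c k s' d)
  from IfTrue.prems IfTrue.hyps(1) obtain k1 where "n = Suc k1" "exec c s k1 s''"
    by (elim exec_elims(7)) simp_all
  with IfTrue.IH[of k1 s''] show ?case by simp
next
  case (IfFalse s x d k s' c)
  from IfFalse.prems IfFalse.hyps(1) obtain k1 where "n = Suc k1" "exec d s k1 s''"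
    by (elim exec_elims(7)) simp_all
  with IfFalse.IH[of k1 s''] show ?case by simp
next
  case (WhileFalse s x c)
  from WhileFalse.prems WhileFalse.hyps show ?case by - (erule exec_elims(8), simp_all)
next
  case (WhileTrue s x c m s' k s1)
  from WhileTrue.prems WhileTrue.hyps(1) obtain m1 r k1
    where "n = Suc (m1 + k1)" "exec c s m1 r" "exec (While x c) r k1 s''"
    by - (erule exec_elims(8), simp_all)
  with WhileTrue.IH(1)[of m1 r] WhileTrue.IH(2)[of k1 s''] show ?case by simp
qed (elim exec_elims(1-5), simp)+

text \<open>
  The input word occupies the memory from address 0, and its length is in register 0; all other
  cells are 0.  On termination register 0 holds the start address of the output word.
\<close>

definition initial :: "nat list \<Rightarrow> config" where
  "initial xs =
     \<lparr>reg = (\<lambda>_. 0)(0 := length xs), mem = (\<lambda>i. if i < length xs then xs ! i else 0)\<rparr>"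

definition has_output :: "config \<Rightarrow> nat list \<Rightarrow> bool" where
  "has_output s ys \<longleftrightarrow> (\<forall>i < length ys. mem s (reg s 0 + i) = ys ! i)"

definition computes_in :: "ram \<Rightarrow> nat list \<Rightarrow> nat \<Rightarrow> nat list \<Rightarrow> bool" where
  "computes_in P xs n ys \<longleftrightarrow> (\<exists>s. exec P (initial xs) n s \<and> has_output s ys)"

text \<open>
  Words representing an automaton over the concrete bags: subsets of \<open>{1..t}\<close> are bit masks, states
  are named by distinct numbers \<open>\<nu> q\<close>, and states, final states and transitions are listed in any
  order, without repetition and preceded by their number.  The length of such a word is linear
  in \<^const>\<open>ta_size\<close>.
\<close>

definition mask :: "nat set \<Rightarrow> nat" where
  "mask B = (\<Sum>i\<in>B. 2 ^ (i - 1))"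

fun trans_word :: "('q \<Rightarrow> nat) \<Rightarrow> 'q list \<times> bag \<times> 'q \<Rightarrow> nat list" where
  "trans_word \<nu> (qs, (B, b), q) = length qs # map \<nu> qs @ [mask B, mask b, \<nu> q]"

definition represents :: "nat \<Rightarrow> nat list \<Rightarrow> ('q, bag) ta \<Rightarrow> bool" where
  "represents t xs A \<longleftrightarrow>
     (\<exists>\<nu> qs fs ds.
        inj_on \<nu> (states A) \<and>
        distinct qs \<and> set qs = states A \<and>
        distinct fs \<and> set fs = final A \<and>
        distinct ds \<and> set ds = trans A \<and>
        xs = [t] @ (length qs # map \<nu> qs) @ (length fs # map \<nu> fs)
             @ (length ds # concat (map (trans_word \<nu>) ds)))"

end

theory Submission
  imports Defs "HOL-Library.Nat_Bijection"
begin

text \<open>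
  A state of the constructed automaton records a state \<open>q\<close> of \<open>A\<close>, the bag \<open>(B', b')\<close> at the root
  of a guessed term \<open>T'\<close> that reaches \<open>q\<close>, and the vertex set \<open>B\<close> at the root of the term \<open>T\<close> being
  read.  Condition (S3) relates only a position and its children, so it can be checked on the states of
  the children.  A transition of \<open>A\<close> thus gives rise to at most \<open>2 ^ (8 * t)\<close> transitions, indexed by the
  eight subsets \<open>B'\<^sub>1, b'\<^sub>1, B\<^sub>1, B'\<^sub>2, b'\<^sub>2, B\<^sub>2, B, b\<close>.  The component \<open>b'\<close> is irrelevant for the
  language; it is kept because without it transitions of \<open>A\<close> that differ only in \<open>b'\<close> would produce
  the same transition several times, and the output must be free of repetitions.

  With \<open>M = 2 ^ t\<close>, states are numbered by \<open>((\<nu> q * M + B') * M + b') * M + B\<close>, which the machine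
  computes from \<open>\<nu> q\<close> without looking anything up.  For every transition of \<open>A\<close> it runs through all
  \<open>c < M ^ 8\<close>, reads the eight subsets off as the base-\<open>M\<close> digits of \<open>c\<close>, and tests them bit by bit.
  There is no division; the leading bit of \<open>x < N\<close> relative to a power of two \<open>N\<close> is obtained by
  doubling \<open>x\<close> and comparing with \<open>N\<close>.
\<close>

section \<open>Weakest preconditions with running time\<close>

text \<open>The last argument of \<open>wp\<close> and of the postcondition is the time consumed so far.\<close>

definition wp :: "ram \<Rightarrow> ((nat \<Rightarrow> nat) \<Rightarrow> (nat \<Rightarrow> nat) \<Rightarrow> nat \<Rightarrow> bool) \<Rightarrow>
    (nat \<Rightarrow> nat) \<Rightarrow> (nat \<Rightarrow> nat) \<Rightarrow> nat \<Rightarrow> bool" where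
  "wp c Q R m k \<longleftrightarrow>
     (\<exists>n s. exec c \<lparr>reg = R, mem = m\<rparr> n s \<and> Q (reg s) (mem s) (k + n))"

lemma config_collapse [simp]: "\<lparr>reg = reg s, mem = mem s\<rparr> = (s :: config)"
  by (cases s) simp

lemma wp_mono:
  assumes "wp c Q R m k" and "\<And>R' m' k'. Q R' m' k' \<Longrightarrow> Q' R' m' k'"
  shows "wp c Q' R m k"
  using assms unfolding wp_def by blast

lemma wp_Const [simp]: "wp (Const x n) Q R m k = Q (R(x := n)) m (Suc k)"
  unfolding wp_def by (force elim: exec_elims intro: exec.intros)

lemma wp_Add [simp]: "wp (Add x y z) Q R m k = Q (R(x := R y + R z)) m (Suc k)"
  unfolding wp_def by (auto elim!: exec_elims intro!: exI exec.intros)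

lemma wp_Sub [simp]: "wp (Sub x y z) Q R m k = Q (R(x := R y - R z)) m (Suc k)"
  unfolding wp_def by (auto elim!: exec_elims intro!: exI exec.intros)

lemma wp_Load [simp]: "wp (Load x y) Q R m k = Q (R(x := m (R y))) m (Suc k)"
  unfolding wp_def by (auto elim!: exec_elims intro!: exI exec.intros)

lemma wp_Store [simp]: "wp (Store x y) Q R m k = Q R (m(R x := R y)) (Suc k)"
  unfolding wp_def by (auto elim!: exec_elims intro!: exI exec.intros)

lemma wp_Seq [simp]: "wp (Seq c d) Q R m k = wp c (wp d Q) R m k"
proof
  assume "wp (Seq c d) Q R m k"
  then obtain n s where "exec (Seq c d) \<lparr>reg = R, mem = m\<rparr> n s" "Q (reg s) (mem s) (k + n)"
    unfolding wp_def by blast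
  then obtain n1 s1 n2 where "exec c \<lparr>reg = R, mem = m\<rparr> n1 s1" "exec d s1 n2 s"
    "Q (reg s) (mem s) (k + n1 + n2)"
    by (auto elim: exec_elims(6) simp: add.assoc)
  then show "wp c (wp d Q) R m k"
    unfolding wp_def by auto
next
  assume "wp c (wp d Q) R m k"
  then obtain n s n' s' where "exec c \<lparr>reg = R, mem = m\<rparr> n s"
    "exec d s n' s'" "Q (reg s') (mem s') (k + n + n')"
    unfolding wp_def by auto
  then show "wp (Seq c d) Q R m k"
    unfolding wp_def by (metis exec.Seq add.assoc)
qed

lemma wp_If [simp]:
  "wp (If x c d) Q R m k = (if R x \<noteq> 0 then wp c Q R m (Suc k) else wp d Q R m (Suc k))"
proof -
  have "exec (If x c d) \<lparr>reg = R, mem = m\<rparr> n s \<longleftrightarrow>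
      (\<exists>n'. n = Suc n' \<and> (if R x \<noteq> 0 then exec c \<lparr>reg = R, mem = m\<rparr> n' s
        else exec d \<lparr>reg = R, mem = m\<rparr> n' s))" for n s
    by (auto elim!: exec_elims(7) intro: exec.intros)
  then show ?thesis
    unfolding wp_def by (cases "R x = 0") (simp_all, (metis add_Suc_right)+)
qed

lemma wp_While_0: "R x = 0 \<Longrightarrow> Q R m (Suc k) \<Longrightarrow> wp (While x c) Q R m k"
  unfolding wp_def using exec.WhileFalse[of "\<lparr>reg = R, mem = m\<rparr>" x c] by force

lemma wp_While_Suc:
  assumes "R x \<noteq> 0" and "wp c (wp (While x c) Q) R m (Suc k)"
  shows "wp (While x c) Q R m k"
proof -
  obtain n s n' s' where *: "exec c \<lparr>reg = R, mem = m\<rparr> n s"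
    "exec (While x c) s n' s'" "Q (reg s') (mem s') (k + Suc (n + n'))"
    using assms(2) unfolding wp_def by (auto simp: add.assoc)
  have "exec (While x c) \<lparr>reg = R, mem = m\<rparr> (Suc (n + n')) s'"
    using exec.WhileTrue[OF _ *(1,2)] assms(1) by simp
  then show ?thesis
    unfolding wp_def using *(3) by blast
qed

text \<open>Every loop of the program counts a register down to 0, so the invariant is indexed by
  the number \<open>j\<close> of rounds left. Induction on \<open>j\<close> gives termination and
  time together; the \<open>Suc k\<close> in \<open>step\<close> and \<open>finish\<close> pays for
  the test.\<close>

lemma wp_While:
  assumes init: "I n R m k"
    and counter: "\<And>j R m k. I j R m k \<Longrightarrow> R x = j"
    and step: "\<And>j R m k. I (Suc j) R m k \<Longrightarrow> j < n \<Longrightarrow> wp c (I j) R m (Suc k)"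
    and finish: "\<And>R m k. I 0 R m k \<Longrightarrow> Q R m (Suc k)"
  shows "wp (While x c) Q R m k"
proof -
  have "j \<le> n \<Longrightarrow> I j R m k \<Longrightarrow> wp (While x c) Q R m k" for j R m k
  proof (induction j arbitrary: R m k)
    case 0
    then show ?case using counter finish by (intro wp_While_0) auto
  next
    case (Suc j)
    have "wp c (I j) R m (Suc k)" using step Suc.prems by auto
    then have "wp c (wp (While x c) Q) R m (Suc k)"
      by (rule wp_mono) (use Suc in auto)
    then show ?case using counter[OF Suc.prems(2)] by (intro wp_While_Suc) auto
  qed
  then show ?thesis using init by blast
qed

section \<open>Statement sequences and words in memory\<close>

fun block :: "ram list \<Rightarrow> ram" where
  "block [] = Const 99 0"
| "block [c] = c"
| "block (c # d # cs) = Seq c (block (d # cs))"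

fun fill :: "(nat \<Rightarrow> nat) \<Rightarrow> nat \<Rightarrow> nat list \<Rightarrow> nat \<Rightarrow> nat" where
  "fill m a [] = m"
| "fill m a (x # xs) = fill (m(a := x)) (Suc a) xs"

lemma fill_append: "fill m a (xs @ ys) = fill (fill m a xs) (a + length xs) ys"
  by (induction xs arbitrary: m a) auto

lemma fill_outside: "b < a \<or> a + length xs \<le> b \<Longrightarrow> fill m a xs b = m b"
  by (induction xs arbitrary: m a) auto

lemma fill_inside: "i < length xs \<Longrightarrow> fill m a xs (a + i) = xs ! i"
proof (induction xs arbitrary: m a i)
  case (Cons x xs)
  show ?case
  proof (cases i)
    case 0
    then show ?thesis by (simp add: fill_outside)
  next
    case (Suc j)
    then have "fill (m(a := x)) (Suc a) xs (Suc a + j) = xs ! j"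
      using Cons.prems by (intro Cons.IH) simp
    then show ?thesis using Suc by simp
  qed
qed simp

text \<open>The header cell of a section lies just below its items but is stored last; this moves
  that write to the front, where it becomes the first cell of the section.\<close>

lemma fill_upd: "b < a \<Longrightarrow> (fill m a xs)(b := x) = fill (m(b := x)) a xs"
  by (induction xs arbitrary: m a) (auto simp: fun_upd_twist)

definition holds :: "(nat \<Rightarrow> nat) \<Rightarrow> nat \<Rightarrow> nat list \<Rightarrow> bool" where
  "holds m a xs \<longleftrightarrow> (\<forall>i < length xs. m (a + i) = xs ! i)"

lemma holds_Nil [simp]: "holds m a []"
  by (simp add: holds_def)

lemma holds_Cons [simp]: "holds m a (x # xs) \<longleftrightarrow> m a = x \<and> holds m (Suc a) xs"
  by (auto simp: holds_def nth_Cons split: nat.split)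

lemma holds_append [simp]:
  "holds m a (xs @ ys) \<longleftrightarrow> holds m a xs \<and> holds m (a + length xs) ys"
  by (induction xs arbitrary: a) auto

text \<open>The input survives because all output is written behind it.\<close>

lemma holds_fill: "a + length xs \<le> b \<Longrightarrow> holds (fill m b ys) a xs \<longleftrightarrow> holds m a xs"
  by (simp add: holds_def fill_outside)

section \<open>Arithmetic subroutines\<close>

text \<open>
  Registers: 0 output address, 2 the constant 1, 3 \<open>t\<close>, 4 \<open>M\<close>, 5 \<open>M ^ 3\<close>, 6 \<open>M ^ 8\<close>, 7 input pointer,
  8 output pointer, 9 number of items written in the current section, 10 address of its header,
  11 items left to read, 12 to 17 the current transition \<open>q\<close>, arity, \<open>q\<^sub>1\<close>, \<open>q\<^sub>2\<close>, \<open>B'\<close>, \<open>b'\<close>,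
  18 the index \<open>c\<close>, 19 a loop counter, 20 the constant 0; 21 to 23 codes of the states in the
  transition being built, 24 to 31 the digits of \<open>c\<close>.  All others are scratch registers.
\<close>

definition Top :: "nat \<Rightarrow> nat \<Rightarrow> nat \<Rightarrow> ram" where
  "Top x N y = block [Add x x x, Add 34 x 2, Sub 34 34 N,
     If 34 (Seq (Sub x x N) (Const y 1)) (Seq (Const y 0) (Const y 0)), Const 34 0]"

text \<open>For \<open>x < N\<close> the quotient of \<open>2 * x\<close> by \<open>N\<close> is a
  bit, and \<open>2 * x + 1 - N\<close> is nonzero precisely if \<open>N \<le> 2 * x\<close>. The
  repeated \<open>Const y 0\<close> gives both branches the same length, and clearing register 34
  makes the final registers an explicit function of the initial ones.\<close>

lemma wp_Top [simp]:
  assumes "R 2 = 1" "R x < R N" "distinct [x, N, y, 34, 2]"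
  shows "wp (Top x N y) Q R m k =
    Q (R(x := 2 * R x mod R N, y := 2 * R x div R N, 34 := 0)) m (k + 7)"
proof -
  have [simp]: "N \<noteq> x" "34 \<noteq> x" "2 \<noteq> x" "y \<noteq> x" "x \<noteq> 34" "N \<noteq> 34" "y \<noteq> 34"
    using assms(3) by auto
  have k: "k + 7 = Suc (Suc (Suc (Suc (Suc (Suc (Suc k))))))" by simp
  show ?thesis
  proof (cases "R N \<le> 2 * R x")
    case True
    have "2 * R x div R N = 1" "2 * R x mod R N = 2 * R x - R N"
      using True assms(2) by (auto simp: div_nat_eqI mod_if)
    then have "R(x := 2 * R x - R N, 34 := 0, y := 1) =
        R(x := 2 * R x mod R N, y := 2 * R x div R N, 34 := 0)"
      by (auto simp: fun_eq_iff)
    then show ?thesis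
      using assms(1,2) True unfolding k by (simp add: Top_def mult_2 fun_upd_twist[of y 34])
  next
    case False
    then have "R(x := 2 * R x, y := 0, 34 := 0) =
        R(x := 2 * R x mod R N, y := 2 * R x div R N, 34 := 0)"
      by (auto simp: fun_eq_iff)
    then show ?thesis
      using assms(1,2) False unfolding k by (simp add: Top_def mult_2)
  qed
qed

definition Double :: "nat \<Rightarrow> ram" where
  "Double x = block [Add 32 3 20, While 32 (block [Add x x x, Sub 32 32 2])]"

lemma wp_Double:
  assumes "R 2 = 1" "R 20 = 0" "distinct [x, 32, 2, 3, 20]"
    and Q: "Q (R(x := R x * 2 ^ R 3, 32 := 0)) m (k + (3 * R 3 + 2))"
  shows "wp (Double x) Q R m k"
proof -
  have [simp]: "x \<noteq> 32" "x \<noteq> 2" "x \<noteq> 3" "x \<noteq> 20" "32 \<noteq> x" "2 \<noteq> x" "3 \<noteq> x" "20 \<noteq> x"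
    using assms(3) by auto
  let ?I = "\<lambda>j R' m' k'. \<exists>i. i + j = R 3 \<and> (\<forall>r. r \<notin> {x, 32} \<longrightarrow> R' r = R r) \<and>
    R' x = R x * 2 ^ i \<and> R' 32 = j \<and> m' = m \<and> k' = Suc k + 3 * i"
  have "wp (While 32 (block [Add x x x, Sub 32 32 2])) Q (R(32 := R 3)) m (Suc k)"
  proof (rule wp_While[where I = ?I and n = "R 3"])
    show "?I (R 3) (R(32 := R 3)) m (Suc k)"
      by (intro exI[of _ 0]) simp
  next
    fix j R' m' k'
    assume "?I (Suc j) R' m' k'"
    then obtain i where "i + Suc j = R 3" "\<forall>r. r \<notin> {x, 32} \<longrightarrow> R' r = R r"
      "R' x = R x * 2 ^ i" "R' 32 = Suc j" "m' = m" "k' = Suc k + 3 * i"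
      by blast
    then show "wp (block [Add x x x, Sub 32 32 2]) (?I j) R' m' (Suc k')"
      using assms(1,2) by simp (intro exI[of _ "Suc i"], simp)
  next
    fix R' m' k'
    assume "?I 0 R' m' k'"
    moreover from this have "R' = R(x := R x * 2 ^ R 3, 32 := 0)"
      by (auto simp: fun_eq_iff)
    ultimately have "m' = m \<and> Suc k' = k + (3 * R 3 + 2) \<and> R' = R(x := R x * 2 ^ R 3, 32 := 0)"
      by auto
    with Q show "Q R' m' (Suc k')" by metis
  qed auto
  then show ?thesis
    using assms(2) by (simp add: Double_def)
qed

definition Extract :: "nat \<Rightarrow> nat \<Rightarrow> nat \<Rightarrow> ram" where
  "Extract x N y = block [Const y 0, Const 34 0, Add 32 3 20, While 32 (block [Top x N 33,
     Add y y y, Add y y 33, Sub 32 32 2]), Const 33 0]"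

text \<open>One step of binary long division by \<open>N\<close>: the bit pushed out of the doubled
  remainder is appended to the quotient.\<close>

lemma mult_power_div_Suc:
  fixes x N :: nat
  assumes "N > 0"
  shows "x * 2 ^ Suc i div N = 2 * (x * 2 ^ i div N) + 2 * (x * 2 ^ i mod N) div N"
proof -
  have "x * 2 ^ Suc i = 2 * (x * 2 ^ i mod N) + N * (2 * (x * 2 ^ i div N))"
    by (metis (no_types, lifting) add.commute distrib_left mult.left_commute mod_mult_div_eq power_Suc)
  then show ?thesis
    using assms by (simp del: power_Suc)
qed

text \<open>For \<open>N = M ^ 8\<close> the \<open>t\<close> doublings push out the leading
  base-\<open>M\<close> digit of \<open>x\<close>, which collects bit by bit in \<open>y\<close>,
  while the other digits of \<open>x\<close> move up by one place.\<close>

lemma wp_Extract: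
  assumes "R 2 = 1" "R 20 = 0" "R x < R N" "distinct [x, N, y, 32, 33, 34, 2, 3, 20]"
    and Q: "Q (R(x := R x * 2 ^ R 3 mod R N, y := R x * 2 ^ R 3 div R N,
      32 := 0, 33 := 0, 34 := 0)) m (k + (11 * R 3 + 5))"
  shows "wp (Extract x N y) Q R m k"
proof -
  let ?c = "block [Top x N 33, Add y y y, Add y y 33, Sub 32 32 2]"
  have [simp]:
    "x \<noteq> 32" "x \<noteq> 33" "x \<noteq> 34" "x \<noteq> 2" "x \<noteq> 3" "x \<noteq> 20" "N \<noteq> 32"
    "N \<noteq> 33" "N \<noteq> 34" "N \<noteq> 2" "N \<noteq> 3" "N \<noteq> 20" "y \<noteq> 32" "y \<noteq> 33"
    "y \<noteq> 34" "y \<noteq> 2" "y \<noteq> 3" "y \<noteq> 20" "32 \<noteq> x" "33 \<noteq> x" "34 \<noteq> x"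
    "2 \<noteq> x" "3 \<noteq> x" "20 \<noteq> x" "32 \<noteq> N" "33 \<noteq> N" "34 \<noteq> N" "2 \<noteq> N"
    "3 \<noteq> N" "20 \<noteq> N" "32 \<noteq> y" "33 \<noteq> y" "34 \<noteq> y" "2 \<noteq> y" "3 \<noteq> y"
    "20 \<noteq> y" "x \<noteq> N" "N \<noteq> x" "x \<noteq> y" "y \<noteq> x" "N \<noteq> y" "y \<noteq> N"
    using assms(4) by auto
  let ?I = "\<lambda>j R' m' k'. \<exists>i. i + j = R 3 \<and> (\<forall>r. r \<notin> {x, y, 32, 33, 34} \<longrightarrow> R' r = R r) \<and>
    R' x = R x * 2 ^ i mod R N \<and> R' y = R x * 2 ^ i div R N \<and> R' 34 = 0 \<and> R' 32 = j \<and> m' = m \<and>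
    k' = k + 3 + 11 * i"
  have "R N > 0" using assms(3) by auto
  have "wp (While 32 ?c) (\<lambda>R' m' k'. Q (R'(33 := 0)) m' (Suc k'))
    (R(y := 0, 34 := 0, 32 := R 3)) m (Suc (Suc (Suc k)))"
  proof (rule wp_While[where I = ?I and n = "R 3"])
    show "?I (R 3) (R(y := 0, 34 := 0, 32 := R 3)) m (Suc (Suc (Suc k)))"
      using assms(3) by (intro exI[of _ 0]) simp
  next
    fix j R' m' k'
    assume "?I (Suc j) R' m' k'"
    then obtain i where *: "i + Suc j = R 3" "\<forall>r. r \<notin> {x, y, 32, 33, 34} \<longrightarrow> R' r = R r"
      "R' x = R x * 2 ^ i mod R N" "R' y = R x * 2 ^ i div R N" "R' 34 = 0" "R' 32 = Suc j" "m' = m"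
      "k' = k + 3 + 11 * i"
      by blast
    have [simp]: "R' N = R N" "R' 2 = 1" "R' 3 = R 3" using * assms(1) by auto
    have "2 * (R x * 2 ^ i mod R N) mod R N = R x * 2 ^ Suc i mod R N"
      by (metis mod_mult_right_eq mult.left_commute power_Suc)
    then show "wp ?c (?I j) R' m' (Suc k')"
      using * \<open>R N > 0\<close> mult_power_div_Suc[OF \<open>R N > 0\<close>, of "R x" i]
      by (simp del: power_Suc) (intro exI[of _ "Suc i"], simp)
  next
    fix R' m' k'
    assume I: "?I 0 R' m' k'"
    then have "R'(33 := 0) = R(x := R x * 2 ^ R 3 mod R N, y := R x * 2 ^ R 3 div R N,
      32 := 0, 33 := 0, 34 := 0)"
      by (auto simp: fun_eq_iff)
    moreover have "m' = m \<and> Suc (Suc k') = k + (11 * R 3 + 5)"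
      using I by auto
    ultimately show "Q (R'(33 := 0)) m' (Suc (Suc k'))"
      using Q by metis
  qed auto
  moreover have "wp (Const 33 0) Q = (\<lambda>R' m' k'. Q (R'(33 := 0)) m' (Suc k'))"
    by (simp add: fun_eq_iff)
  ultimately show ?thesis
    using assms(2) by (simp add: Extract_def)
qed

section \<open>Base-\<open>M\<close> digits and their extraction by shifting\<close>

definition digit :: "nat \<Rightarrow> nat \<Rightarrow> nat \<Rightarrow> nat" where
  "digit M c i = c div M ^ i mod M"

lemma digit_less: "M > 0 \<Longrightarrow> digit M c i < M"
  by (simp add: digit_def)

text \<open>Induction on the number of digits, splitting off the leading one: it is the quotient by
  \<open>M ^ n\<close>, and the remainder keeps all lower digits.\<close>

lemma digit_eqI:
  assumes "c < M ^ n" "c' < M ^ n" "\<And>i. i < n \<Longrightarrow> digit M c i = digit M c' i"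
  shows "c = c'"
  using assms
proof (induction n arbitrary: c c')
  case (Suc n)
  then have "M > 0" by (cases "M = 0") auto
  have *: "e div M ^ n = digit M e n" if "e < M ^ Suc n" for e
    using that by (simp add: digit_def less_mult_imp_div_less mult.commute)
  have "digit M (e mod M ^ n) i = digit M e i" if "i < n" for e i
  proof -
    have "M ^ n = M ^ i * (M * M ^ (n - Suc i))"
      using that by (simp flip: power_Suc power_add)
    then show ?thesis
      by (simp add: digit_def mod_mult2_eq[of e "M ^ i"] \<open>M > 0\<close> mod_mod_cancel)
  qed
  then have "digit M (c mod M ^ n) i = digit M (c' mod M ^ n) i" if "i < n" for i
    using Suc.prems(3)[of i] that by simp
  then have "c mod M ^ n = c' mod M ^ n"
    by (rule Suc.IH[rotated 2]) (use \<open>M > 0\<close> in simp_all)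
  moreover have "c div M ^ n = c' div M ^ n"
    using * Suc.prems by auto
  ultimately show ?case
    by (metis div_mult_mod_eq)
qed auto

text \<open>Makes the run over all \<open>c < M ^ 8\<close> exhaustive, as every choice of eight
  digits occurs. A new leading digit enters as a multiple of \<open>M ^ n\<close>, which the lower
  digits do not see.\<close>

lemma ex_digits:
  fixes M :: nat
  assumes "\<And>i. i < n \<Longrightarrow> f i < M"
  shows "\<exists>c < M ^ n. \<forall>i < n. digit M c i = f i"
  using assms
proof (induction n)
  case (Suc n)
  then obtain c where c: "c < M ^ n" "\<forall>i < n. digit M c i = f i" by fastforce
  have "f n < M" "M > 0" using Suc.prems[of n] by auto
  let ?e = "c + M ^ n * f n"
  have "digit M ?e i = f i" if "i < Suc n" for i
  proof (cases "i = n")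
    case True
    then show ?thesis using c \<open>f n < M\<close> \<open>M > 0\<close> by (simp add: digit_def)
  next
    case False
    then have "M ^ n = M ^ i * (M * M ^ (n - Suc i))" "i < n"
      using that by (simp_all flip: power_Suc power_add)
    then have e: "?e = c + M ^ i * (M * (M ^ (n - Suc i) * f n))" by (simp add: mult.assoc)
    have "digit M ?e i = digit M c i"
      unfolding digit_def e using \<open>M > 0\<close> by simp
    then show ?thesis using c(2) \<open>i < n\<close> by (simp only:)
  qed
  moreover have "?e < M ^ Suc n"
  proof -
    have "?e < M ^ n + M ^ n * f n" using c by simp
    also have "\<dots> = M ^ n * Suc (f n)" by simp
    also have "\<dots> \<le> M ^ n * M" using \<open>f n < M\<close> by (intro mult_le_mono2) simp
    finally show ?thesis by (simp add: mult.commute)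
  qed
  ultimately show ?case by blast
qed auto

text \<open>After \<open>i\<close> extractions the working register holds
  \<open>c * M ^ i mod M ^ n\<close>, so digits come out from the most significant
  downwards.\<close>

lemma digit_shift:
  assumes "M > 0" "n = Suc (i + j)"
  shows "c * M ^ i mod M ^ n * M div M ^ n = digit M c j"
proof -
  have "c * M ^ i mod M ^ n = M ^ i * (c mod (M ^ j * M))"
    using mod_mult_mult1[of "M ^ i" c "M ^ j * M"] assms by (simp add: power_add ac_simps)
  then have "c * M ^ i mod M ^ n * M div M ^ n = (M ^ i * M) * (c mod (M ^ j * M)) div ((M ^ i * M) * M ^ j)"
    using assms by (simp add: power_add ac_simps)
  also have "\<dots> = c mod (M ^ j * M) div M ^ j"
    using assms by (intro div_mult_mult1) auto
  also have "\<dots> = digit M c j"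
    using assms by (simp add: mod_mult2_eq digit_def)
  finally show ?thesis .
qed

text \<open>The binary counterpart of \<open>digit_shift\<close>: after \<open>i\<close> doublings
  modulo \<open>2 ^ t\<close>, the next bit pushed out is bit \<open>t - 1 - i\<close>.\<close>

lemma top_bit:
  fixes x :: nat
  assumes "t = i + Suc j"
  shows "2 * (x * 2 ^ i mod 2 ^ t) div 2 ^ t = of_bool (bit x j)"
proof -
  have "2 * (x * 2 ^ i mod 2 ^ t) = 2 ^ Suc i * (x mod (2 ^ j * 2))"
    using mod_mult_mult1[of "2 ^ i" x "2 ^ j * 2"] assms by (simp add: power_add ac_simps)
  moreover have "(2 :: nat) ^ t = 2 ^ Suc i * 2 ^ j"
    using assms by (simp add: power_add ac_simps)
  ultimately have "2 * (x * 2 ^ i mod 2 ^ t) div 2 ^ t = x mod (2 ^ j * 2) div 2 ^ j"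
    by (metis div_mult_mult1 power_not_zero zero_neq_numeral)
  also have "\<dots> = of_bool (bit x j)"
    by (simp add: mod_mult2_eq bit_iff_odd mod2_eq_if)
  finally show ?thesis .
qed

section \<open>Processing a transition\<close>

text \<open>The conditions on one vertex: \<open>x'\<close>, \<open>x\<close>, \<open>y\<close> are
  the masks of \<open>B'\<close>, \<open>B\<close>, \<open>b\<close>, and \<open>u'\<close>,
  \<open>u\<close> and \<open>v'\<close>, \<open>v\<close> those of the vertex sets of the two
  children in \<open>T'\<close> and \<open>T\<close>. The first line says that \<open>b\<close> lies
  in \<open>B\<close> and \<open>B\<close> in \<open>B'\<close>; the others are (S3) for the two
  edges.\<close>

definition compatible_bit :: "nat \<Rightarrow> nat \<Rightarrow> nat \<Rightarrow> nat \<Rightarrow> nat \<Rightarrow> nat \<Rightarrow> nat \<Rightarrow> nat \<Rightarrow> bool" where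
  "compatible_bit x' x y u' u v' v k \<longleftrightarrow>
     (bit x k \<longrightarrow> bit x' k) \<and> (bit y k \<longrightarrow> bit x k) \<and>
     (bit x' k \<longrightarrow> bit u' k \<longrightarrow> (bit x k \<longleftrightarrow> bit u k)) \<and>
     (bit x' k \<longrightarrow> bit v' k \<longrightarrow> (bit x k \<longleftrightarrow> bit v k))"

text \<open>
  For bits \<open>x', u', x, u\<close> this is nonzero precisely if \<open>x' = u' = 1\<close> and \<open>x \<noteq> u\<close>; sums of such terms
  express a conjunction of tests without branching.
\<close>

definition disagreement :: "nat \<Rightarrow> nat \<Rightarrow> nat \<Rightarrow> nat \<Rightarrow> nat" where
  "disagreement x' u' x u = (x - u) + (u - x) + x' + u' - 2"

lemma disagreement_of_bool [simp]:
  "disagreement (of_bool p') (of_bool q') (of_bool p) (of_bool q) = 0 \<longleftrightarrow> (p' \<longrightarrow> q' \<longrightarrow> (p \<longleftrightarrow> q))"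
  by (simp add: disagreement_def of_bool_def)

definition Disagreement :: "nat \<Rightarrow> nat \<Rightarrow> ram" where
  "Disagreement u' u = block [Sub 51 44 u, Sub 52 u 44, Add 51 51 52, Add 51 51 43, Add 51 51 u',
     Sub 51 51 53, Add 50 50 51, Const 52 0]"

lemma wp_Disagreement [simp]:
  assumes "R 53 = 2" "distinct [u', u, 50, 51, 52, 43, 44, 53]"
  shows "wp (Disagreement u' u) Q R m k =
    Q (R(50 := R 50 + disagreement (R 43) (R u') (R 44) (R u),
         51 := disagreement (R 43) (R u') (R 44) (R u), 52 := 0)) m (k + 8)"
proof -
  have [simp]: "u' \<noteq> 51" "u' \<noteq> 52" "u \<noteq> 51" "u \<noteq> 52" using assms(2) by auto
  have k: "k + 8 = Suc (Suc (Suc (Suc (Suc (Suc (Suc (Suc k)))))))" by simp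
  show ?thesis
    unfolding k by (simp add: assms(1) Disagreement_def disagreement_def fun_upd_twist)
qed

definition Compare :: ram where
  "Compare = block [Top 36 4 43, Top 37 4 44, Top 38 4 45, Top 39 4 46, Top 40 4 47,
     Top 41 4 48, Top 42 4 49,
     Sub 51 44 43, Add 50 50 51, Sub 51 45 44, Add 50 50 51,
     Disagreement 46 47, Disagreement 48 49, Sub 54 54 2]"

definition Check :: ram where
  "Check = block [Add 36 16 20, Add 37 30 20, Add 38 31 20, Add 39 24 20, Add 40 26 20,
     Add 41 27 20, Add 42 29 20, Const 50 0, Const 53 2, Add 54 3 20, While 54 Compare]"

text \<open>\<open>Top\<close> destroys its argument, so copies of the masks are tested. A round
  costs 71 steps: the loop test, seven \<open>Top\<close> of 7 steps, four for the two inclusions, 8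
  for each child, and the decrement. Register 50 sums natural numbers and thus stays 0 exactly if
  every test on every bit succeeds.\<close>

lemma wp_Check:
  assumes "R 2 = 1" "R 20 = 0" "R 3 = t" "R 4 = 2 ^ t"
    and lt: "R 16 < 2 ^ t" "R 30 < 2 ^ t" "R 31 < 2 ^ t" "R 24 < 2 ^ t" "R 26 < 2 ^ t" "R 27 < 2 ^ t"
      "R 29 < 2 ^ t"
    and Q: "\<And>R'. (\<And>r. r < 32 \<Longrightarrow> R' r = R r) \<Longrightarrow>
      R' 50 = 0 \<longleftrightarrow>
        (\<forall>k < t. compatible_bit (R 16) (R 30) (R 31) (R 24) (R 26) (R 27) (R 29) k) \<Longrightarrow>
      Q R' m (k + (71 * t + 11))"
  shows "wp Check Q R m k"
proof -
  let ?c = "compatible_bit (R 16) (R 30) (R 31) (R 24) (R 26) (R 27) (R 29)"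
  let ?J = "\<lambda>i j R'. i + j = t \<and> (\<forall>r < 32. R' r = R r) \<and>
    R' 36 = R 16 * 2 ^ i mod 2 ^ t \<and> R' 37 = R 30 * 2 ^ i mod 2 ^ t \<and>
    R' 38 = R 31 * 2 ^ i mod 2 ^ t \<and> R' 39 = R 24 * 2 ^ i mod 2 ^ t \<and>
    R' 40 = R 26 * 2 ^ i mod 2 ^ t \<and> R' 41 = R 27 * 2 ^ i mod 2 ^ t \<and>
    R' 42 = R 29 * 2 ^ i mod 2 ^ t \<and> R' 53 = 2 \<and> R' 54 = j \<and>
    (R' 50 = 0 \<longleftrightarrow> (\<forall>k. j \<le> k \<longrightarrow> k < t \<longrightarrow> ?c k))"
  let ?I = "\<lambda>j R' m' k'. \<exists>i. ?J i j R' \<and> m' = m \<and> k' = k + 10 + 71 * i"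
  define R0 where "R0 = R(36 := R 16, 37 := R 30, 38 := R 31, 39 := R 24, 40 := R 26, 41 := R 27,
    42 := R 29, 50 := 0, 53 := 2, 54 := t)"
  have "wp (While 54 Compare) Q R0 m (k + 10)"
  proof (rule wp_While[where I = ?I and n = t])
    show "?I t R0 m (k + 10)"
      using lt by (intro exI[of _ 0]) (simp add: R0_def)
  next
    fix j R' m' k'
    assume "?I (Suc j) R' m' k'"
    then obtain i where i: "?J i (Suc j) R' \<and> m' = m \<and> k' = k + 10 + 71 * i" by (elim exE)
    then have J: "?J i (Suc j) R'" and [simp]: "m' = m" "k' = k + 10 + 71 * i" by simp_all
    have t: "t = i + Suc j" using J by simp
    have [simp]: "R' 2 = 1" "R' 20 = 0" "R' 3 = t" "R' 4 = 2 ^ t" "R' 53 = 2"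
      "R' 36 = R 16 * 2 ^ i mod 2 ^ t" "R' 37 = R 30 * 2 ^ i mod 2 ^ t"
      "R' 38 = R 31 * 2 ^ i mod 2 ^ t" "R' 39 = R 24 * 2 ^ i mod 2 ^ t"
      "R' 40 = R 26 * 2 ^ i mod 2 ^ t" "R' 41 = R 27 * 2 ^ i mod 2 ^ t"
      "R' 42 = R 29 * 2 ^ i mod 2 ^ t" "R' 54 = Suc j"
      using J assms(1-4) by auto
    have *: "2 * (x * 2 ^ i mod 2 ^ t) mod 2 ^ t = x * 2 ^ Suc i mod 2 ^ t" for x :: nat
      by (metis mod_mult_right_eq mult.left_commute power_Suc)
    \<comment> \<open>Bits arrive from the top: with \<open>Suc j\<close> rounds left the positions
      above \<open>j\<close> are done, and this round adds position \<open>j\<close>.\<close>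
    have "(\<forall>k. j \<le> k \<longrightarrow> k < t \<longrightarrow> P k) \<longleftrightarrow> P j \<and> (\<forall>k. Suc j \<le> k \<longrightarrow> k < t \<longrightarrow> P k)" for P
      using t by (auto simp: Suc_le_eq) (metis le_neq_implies_less)
    then have v: "(\<forall>k. j \<le> k \<longrightarrow> k < t \<longrightarrow> ?c k) \<longleftrightarrow> ?c j \<and> R' 50 = 0"
      using J by blast
    have of_bool_diff: "of_bool p - of_bool q = (0 :: nat) \<longleftrightarrow> (p \<longrightarrow> q)" for p q
      by (simp add: of_bool_def)
    note bit_j = compatible_bit_def[of "R 16" "R 30" "R 31" "R 24" "R 26" "R 27" "R 29" j]
    show "wp Compare (?I j) R' m' (Suc k')"
    proof -
      \<comment> \<open>An arbitrary postcondition \<open>Inv\<close> keeps the invariant opaque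
        while the simplifier computes the registers.\<close>
      have Compare: "wp Compare Inv R' m (Suc k')"
        if "\<And>R2 k2. ?J (Suc i) j R2 \<Longrightarrow> k2 = k' + 71 \<Longrightarrow> Inv R2 m k2" for Inv
        unfolding Compare_def
        apply (simp only: block.simps wp_Seq wp_Add wp_Sub)
        apply (simp add: top_bit[OF t] * del: power_Suc split del: split_of_bool)
        apply (rule that)
         apply (intro conjI)
        using J apply (simp_all add: * v bit_j of_bool_diff del: power_Suc split del: split_of_bool)
        apply blast
        done
      show ?thesis
        by (simp only: \<open>m' = m\<close>) (rule Compare, rule exI[of _ "Suc i"], simp)
    qed
  next
    fix R' m' k'
    assume "?I 0 R' m' k'"
    then obtain i where "?J i 0 R' \<and> m' = m \<and> k' = k + 10 + 71 * i" by (elim exE)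
    then have *: "?J i 0 R'" and "m' = m" "Suc k' = k + (71 * t + 11)" by simp_all
    from * have "Q R' m (k + (71 * t + 11))"
      by (intro Q) simp_all
    then show "Q R' m' (Suc k')"
      by (simp only: \<open>m' = m\<close> \<open>Suc k' = k + (71 * t + 11)\<close>)
  next
    fix j R' m' k'
    assume "?I j R' m' k'"
    then show "R' 54 = j" by (elim exE conjE)
  qed
  moreover have "k + 10 = Suc (Suc (Suc (Suc (Suc (Suc (Suc (Suc (Suc (Suc k)))))))))" by simp
  ultimately show ?thesis
    using assms(1-4) by (simp add: Check_def R0_def)
qed

section \<open>Codes of states, and the treatment of a single index \<open>c\<close>\<close>

definition code :: "nat \<Rightarrow> nat \<Rightarrow> nat \<Rightarrow> nat \<Rightarrow> nat \<Rightarrow> nat" where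
  "code M q x' y' x = ((q * M + x') * M + y') * M + x"

definition Code :: "nat \<Rightarrow> nat \<Rightarrow> nat \<Rightarrow> nat \<Rightarrow> nat \<Rightarrow> ram" where
  "Code z q a b c = block [Add z q 20, Double z, Add z z a, Double z, Add z z b, Double z, Add z z c]"

lemma wp_Code:
  assumes "R 2 = 1" "R 20 = 0" "z \<notin> {a, b, c, 32, 2, 3, 20}" "32 \<notin> {a, b, c}"
    and Q: "Q (R(z := code (2 ^ R 3) (R q) (R a) (R b) (R c), 32 := 0)) m (k + (9 * R 3 + 10))"
  shows "wp (Code z q a b c) Q R m k"
proof -
  have [simp]: "z \<noteq> 32" "32 \<noteq> z" "z \<noteq> 2" "2 \<noteq> z" "z \<noteq> 3" "3 \<noteq> z" "z \<noteq> 20" "20 \<noteq> z"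
    "a \<noteq> z" "b \<noteq> z" "c \<noteq> z" "a \<noteq> 32" "b \<noteq> 32" "c \<noteq> 32"
    using assms(3,4) by auto
  have k: "k + (9 * R 3 + 10) = Suc (Suc (Suc (Suc (k + (3 * R 3 + 2) + (3 * R 3 + 2) + (3 * R 3 + 2)))))"
    by simp
  have "Q (R(z := code (2 ^ R 3) (R q) (R a) (R b) (R c), 32 := 0)) m
    (Suc (Suc (Suc (Suc (k + (3 * R 3 + 2) + (3 * R 3 + 2) + (3 * R 3 + 2))))))"
    using Q unfolding k .
  then show ?thesis
    unfolding Code_def using assms(1,2)
    by (auto intro!: wp_Double simp: code_def fun_upd_twist)
qed

fun Digits :: "nat \<Rightarrow> ram" where
  "Digits 0 = Add 55 18 20"
| "Digits (Suc n) = Seq (Digits n) (Extract 55 6 (24 + n))"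

text \<open>The leading digit comes first, so register \<open>24 + i\<close> receives digit
  \<open>7 - i\<close>; registers 24 to 31 hold \<open>B'\<^sub>1, b'\<^sub>1, B\<^sub>1,
  B'\<^sub>2, b'\<^sub>2, B\<^sub>2, B, b\<close> in this order.\<close>

lemma wp_Digits:
  assumes "R 2 = 1" "R 20 = 0" and M: "2 ^ R 3 = M" and R: "R 6 = M ^ 8" "R 18 < M ^ 8"
    and "n \<le> 8"
  shows "wp (Digits n) (\<lambda>R' m' k'. (\<forall>r < 24. R' r = R r) \<and> R' 55 = R 18 * M ^ n mod M ^ 8 \<and>
      (\<forall>i < n. R' (24 + i) = digit M (R 18) (7 - i)) \<and> m' = m \<and> k' = Suc k + (11 * R 3 + 5) * n) R m k"
  using \<open>n \<le> 8\<close>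
proof (induction n)
  case 0
  then show ?case using assms by simp
next
  case (Suc n)
  have "M > 0" using M by auto
  then have shift: "R 18 * M ^ n mod M ^ 8 * M div M ^ 8 = digit M (R 18) (7 - n)"
    using Suc.prems by (intro digit_shift) auto
  have mod: "R 18 * M ^ n mod M ^ 8 * M mod M ^ 8 = R 18 * M ^ Suc n mod M ^ 8"
    by (metis mod_mult_left_eq mult.assoc mult.commute power_Suc)
  have "wp (Digits n) (\<lambda>R' m' k'. (\<forall>r < 24. R' r = R r) \<and> R' 55 = R 18 * M ^ n mod M ^ 8 \<and>
      (\<forall>i < n. R' (24 + i) = digit M (R 18) (7 - i)) \<and> m' = m \<and> k' = Suc k + (11 * R 3 + 5) * n) R m k"
    using Suc by simp
  then show ?case
    unfolding Digits.simps wp_Seq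
  proof (rule wp_mono, elim conjE)
    fix R' m' k'
    assume *: "\<forall>r < 24. R' r = R r" "R' 55 = R 18 * M ^ n mod M ^ 8"
      "\<forall>i < n. R' (24 + i) = digit M (R 18) (7 - i)" "m' = m" "k' = Suc k + (11 * R 3 + 5) * n"
    have [simp]: "R' 2 = 1" "R' 3 = R 3" "R' 20 = 0" "R' 6 = M ^ 8" using * assms by auto
    show "wp (Extract 55 6 (24 + n)) (\<lambda>R' m' k'. (\<forall>r < 24. R' r = R r) \<and>
      R' 55 = R 18 * M ^ Suc n mod M ^ 8 \<and> (\<forall>i < Suc n. R' (24 + i) = digit M (R 18) (7 - i)) \<and>
      m' = m \<and> k' = Suc k + (11 * R 3 + 5) * Suc n) R' m' k'"
      using * Suc.prems \<open>M > 0\<close>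
      by (intro wp_Extract) (auto simp: M shift mod less_Suc_eq simp del: power_Suc)
  qed
qed

definition Decode :: ram where
  "Decode = block [Digits 8, Code 21 14 24 25 26, Code 22 15 27 28 29, Code 23 12 16 17 30]"

text \<open>One copy of \<open>c\<close>, eight extractions of \<open>11 * t + 5\<close> steps and
  three codes of \<open>9 * t + 10\<close> steps add up to \<open>115 * t + 71\<close>.\<close>

lemma wp_Decode:
  assumes "R 2 = 1" "R 20 = 0" and M: "2 ^ R 3 = M" and R: "R 6 = M ^ 8" "R 18 < M ^ 8"
    and Q: "\<And>R'. \<lbrakk>\<And>r. r < 21 \<Longrightarrow> R' r = R r; \<And>i. i < 8 \<Longrightarrow> R' (24 + i) = digit M (R 18) (7 - i);
      R' 21 = code M (R 14) (digit M (R 18) 7) (digit M (R 18) 6) (digit M (R 18) 5);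
      R' 22 = code M (R 15) (digit M (R 18) 4) (digit M (R 18) 3) (digit M (R 18) 2);
      R' 23 = code M (R 12) (R 16) (R 17) (digit M (R 18) 1)\<rbrakk>
      \<Longrightarrow> Q R' m (k + (115 * R 3 + 71))"
  shows "wp Decode Q R m k"
proof -
  show ?thesis
    unfolding Decode_def block.simps wp_Seq
  proof (rule wp_mono[OF wp_Digits[OF assms(1-5)]], simp, elim conjE)
    fix R' m' k'
    assume *: "\<forall>r < 24. R' r = R r" 
      "\<forall>i < 8. R' (24 + i) = digit M (R 18) (7 - i)" "m' = m" "k' = Suc k + (11 * R 3 + 5) * 8"
    have f: "R' 24 = digit M (R 18) 7" "R' 25 = digit M (R 18) 6" "R' 26 = digit M (R 18) 5"
      "R' 27 = digit M (R 18) 4" "R' 28 = digit M (R 18) 3" "R' 29 = digit M (R 18) 2"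
      "R' 30 = digit M (R 18) 1"
      using *(2)[rule_format, of 0] *(2)[rule_format, of 1] *(2)[rule_format, of 2]
        *(2)[rule_format, of 3] *(2)[rule_format, of 4] *(2)[rule_format, of 5] *(2)[rule_format, of 6]
      by simp_all
    have [simp]: "R' 2 = 1" "R' 3 = R 3" "R' 20 = 0" "R' 14 = R 14" "R' 15 = R 15" "R' 12 = R 12"
      "R' 16 = R 16" "R' 17 = R 17" using * assms by auto
    have k: "k' + (9 * R 3 + 10) + (9 * R 3 + 10) + (9 * R 3 + 10) = k + (115 * R 3 + 71)"
      using * by simp
    have "Q (R'(32 := 0, 21 := code M (R 14) (digit M (R 18) 7) (digit M (R 18) 6) (digit M (R 18) 5),
      22 := code M (R 15) (digit M (R 18) 4) (digit M (R 18) 3) (digit M (R 18) 2),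
      23 := code M (R 12) (R 16) (R 17) (digit M (R 18) 1))) m (k + (115 * R 3 + 71))"
      using * by (intro Q) auto
    then show "wp (Code 21 14 24 25 26) (wp (Code 22 15 27 28 29) (wp (Code 23 12 16 17 30) Q)) R' m' k'"
      unfolding k[symmetric] \<open>m' = m\<close>
      by (intro wp_Code) (simp_all add: f M fun_upd_twist)
  qed
qed

text \<open>Digits of absent children must vanish, so that a transition of arity below two arises
  from one index only. That \<open>b\<close> is empty or equal to \<open>b'\<close> is the sub-bag
  condition for pairs.\<close>

definition admissible :: "nat \<Rightarrow> nat \<Rightarrow> nat \<Rightarrow> nat \<Rightarrow> nat \<Rightarrow> bool" where
  "admissible t r x' y' c \<longleftrightarrow> (let d = digit (2 ^ t) c in
     (\<forall>k < t. compatible_bit x' (d 1) (d 0) (d 7) (d 5) (d 4) (d 2) k) \<and>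
     (d 0 = 0 \<or> d 0 = y') \<and>
     (r = 0 \<longrightarrow> d 7 = 0 \<and> d 6 = 0 \<and> d 5 = 0) \<and>
     (r \<le> 1 \<longrightarrow> d 4 = 0 \<and> d 3 = 0 \<and> d 2 = 0))"

definition sub_word :: "nat \<Rightarrow> nat \<Rightarrow> nat \<Rightarrow> nat \<Rightarrow> nat \<Rightarrow> nat \<Rightarrow> nat \<Rightarrow> nat \<Rightarrow> nat list" where
  "sub_word M r q1 q2 x' y' q c = (let d = digit M c in
     r # take r [code M q1 (d 7) (d 6) (d 5), code M q2 (d 4) (d 3) (d 2)] @
     [d 1, d 0, code M q x' y' (d 1)])"

definition emitted :: "nat \<Rightarrow> nat \<Rightarrow> nat \<Rightarrow> nat \<Rightarrow> nat \<Rightarrow> nat \<Rightarrow> nat \<Rightarrow> nat \<Rightarrow> nat list list" where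
  "emitted t r q1 q2 x' y' q c =
     (if admissible t r x' y' c then [sub_word (2 ^ t) r q1 q2 x' y' q c] else [])"

text \<open>Both truncated differences together add the distance of \<open>b\<close> and
  \<open>b'\<close> to register 50. The machine has no skip statement; writing the scratch register
  51 serves as the empty branch.\<close>

definition Restrict :: ram where
  "Restrict = block [
     If 31 (block [Sub 51 31 17, Add 50 50 51, Sub 51 17 31, Add 50 50 51]) (Const 51 0),
     If 13
       (block [Sub 51 13 2,
          If 51 (Const 51 0) (block [Add 50 50 27, Add 50 50 28, Add 50 50 29])])
       (block [Add 50 50 24, Add 50 50 25, Add 50 50 26, Add 50 50 27, Add 50 50 28, Add 50 50 29])]"

text \<open>From here on branches differ in length, so the time is bounded instead of
  computed.\<close>

lemma wp_Restrict:
  assumes "R 2 = 1"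
  shows "wp Restrict (\<lambda>R' m' k'. (\<forall>r < 50. R' r = R r) \<and>
    (R' 50 = 0 \<longleftrightarrow> R 50 = 0 \<and> (R 31 = 0 \<or> R 31 = R 17) \<and>
      (R 13 = 0 \<longrightarrow> R 24 = 0 \<and> R 25 = 0 \<and> R 26 = 0) \<and>
      (R 13 \<le> 1 \<longrightarrow> R 27 = 0 \<and> R 28 = 0 \<and> R 29 = 0)) \<and> m' = m \<and> k' \<le> k + 12) R m k"
  using assms by (auto simp: Restrict_def)

definition Emit :: ram where
  "Emit = block [Store 8 13, Add 8 8 2,
     If 13
       (block [Store 8 21, Add 8 8 2, Sub 51 13 2,
          If 51 (block [Store 8 22, Add 8 8 2]) (Const 51 0)])
       (Const 51 0),
     Store 8 30, Add 8 8 2, Store 8 31, Add 8 8 2, Store 8 23, Add 8 8 2, Add 9 9 2]"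

lemma wp_Emit:
  assumes "R 2 = 1" "R 13 \<le> 2"
  shows "wp Emit (\<lambda>R' m' k'. (\<forall>r < 21. r \<notin> {8, 9} \<longrightarrow> R' r = R r) \<and>
    R' 8 = R 8 + (4 + R 13) \<and> R' 9 = Suc (R 9) \<and>
    m' = fill m (R 8) (R 13 # take (R 13) [R 21, R 22] @ [R 30, R 31, R 23]) \<and> k' \<le> k + 16) R m k"
proof -
  consider "R 13 = 0" | "R 13 = 1" | "R 13 = 2" using assms(2) by linarith
  then show ?thesis
    by cases (use assms(1) in \<open>simp_all add: Emit_def\<close>)
qed

definition Step :: ram where
  "Step = block [Decode, Check, Restrict, If 50 (Const 51 0) Emit]"

text \<open>The bound collects \<open>115 * t + 71\<close> for decoding, \<open>71 * t + 11\<close>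
  for the bitwise check, 12 for \<open>Restrict\<close>, and at most 17 for the conditional
  output.\<close>

lemma wp_Step:
  assumes "R 2 = 1" "R 20 = 0" "R 3 = t" "R 4 = 2 ^ t" "R 6 = (2 ^ t) ^ 8"
    "R 18 < (2 ^ t) ^ 8" "R 16 < 2 ^ t" "R 13 \<le> 2"
    and w: "w = emitted t (R 13) (R 14) (R 15) (R 16) (R 17) (R 12) (R 18)"
  shows "wp Step (\<lambda>R' m' k'. (\<forall>r < 21. r \<notin> {8, 9} \<longrightarrow> R' r = R r) \<and>
    R' 8 = R 8 + length (concat w) \<and> R' 9 = R 9 + length w \<and>
    m' = fill m (R 8) (concat w) \<and> k' \<le> k + (186 * t + 112)) R m k"
  unfolding Step_def block.simps wp_Seq
proof (rule wp_Decode[where M = "2 ^ t"], goal_cases)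
  case (6 R1)
  let ?d = "digit (2 ^ t) (R 18)"
  have d: "?d i < 2 ^ t" for i by (simp add: digit_less)
  have R1: "R1 2 = 1" "R1 20 = 0" "R1 3 = t" "R1 4 = 2 ^ t" "R1 16 = R 16" "R1 17 = R 17" "R1 13 = R 13"
    "R1 8 = R 8" "R1 9 = R 9"
    "R1 24 = ?d 7" "R1 25 = ?d 6" "R1 26 = ?d 5" "R1 27 = ?d 4" "R1 28 = ?d 3" "R1 29 = ?d 2"
    "R1 30 = ?d 1" "R1 31 = ?d 0"
    using 6(1) assms(1-4) 6(2)[of 0] 6(2)[of 1] 6(2)[of 2] 6(2)[of 3] 6(2)[of 4] 6(2)[of 5] 6(2)[of 6]
      6(2)[of 7] by simp_all
  show ?case
  proof (rule wp_Check[where t = t], goal_cases)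
    case (12 R2)
    have R2: "R2 r = R1 r" if "r < 32" for r using 12(1) that .
    have "R2 2 = 1" using R1 R2 by simp
    show ?case
    proof (rule wp_mono[OF wp_Restrict], fact, elim conjE)
      fix R3 m' k'
      assume *: "\<forall>r < 50. R3 r = R2 r" "m' = m" "k' \<le> k + (115 * R 3 + 71) + (71 * t + 11) + 12"
        "R3 50 = 0 \<longleftrightarrow> R2 50 = 0 \<and> (R2 31 = 0 \<or> R2 31 = R2 17) \<and>
        (R2 13 = 0 \<longrightarrow> R2 24 = 0 \<and> R2 25 = 0 \<and> R2 26 = 0) \<and>
        (R2 13 \<le> 1 \<longrightarrow> R2 27 = 0 \<and> R2 28 = 0 \<and> R2 29 = 0)"
      have R3: "R3 r = R1 r" if "r < 32" for r using *(1) R2 that by simp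
      have adm: "R3 50 = 0 \<longleftrightarrow> admissible t (R 13) (R 16) (R 17) (R 18)"
        using *(4) 12(2) R1 R2 by (simp add: admissible_def Let_def)
      show "wp (If 50 (Const 51 0) Emit) (\<lambda>R' m' k'. (\<forall>r < 21. r \<notin> {8, 9} \<longrightarrow> R' r = R r) \<and>
          R' 8 = R 8 + length (concat w) \<and> R' 9 = R 9 + length w \<and>
          m' = fill m (R 8) (concat w) \<and> k' \<le> k + (186 * t + 112)) R3 m' k'"
      proof (cases "R3 50 = 0")
        case True
        have w': "w = [R3 13 # take (R3 13) [R3 21, R3 22] @ [R3 30, R3 31, R3 23]]"
          using True adm w 6 R1 R3 by (simp add: emitted_def sub_word_def Let_def)
        have len: "length (concat w) = 4 + R3 13"
          unfolding w' using R3 R1 assms(8) by simp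
        have "wp Emit (\<lambda>R' m' k'. (\<forall>r < 21. r \<notin> {8, 9} \<longrightarrow> R' r = R r) \<and>
          R' 8 = R 8 + length (concat w) \<and> R' 9 = R 9 + length w \<and>
          m' = fill m (R 8) (concat w) \<and> k' \<le> k + (186 * t + 112)) R3 m' (Suc k')"
          by (rule wp_mono[OF wp_Emit]) (use R3 R1 assms(3,8) 6(1) * len w' in auto)
        then show ?thesis using True by simp
      next
        case False
        then have "w = []" using adm w by (simp add: emitted_def)
        then show ?thesis
          using False * R3 R1 6(1) assms(3) by simp
      qed
    qed
  qed (use R1 d assms in auto)
qed (use assms in auto)

section \<open>The program\<close>

definition env :: "nat \<Rightarrow> nat \<Rightarrow> (nat \<Rightarrow> nat) \<Rightarrow> bool" where
  "env t L R \<longleftrightarrow> R 0 = L \<and> R 2 = 1 \<and> R 3 = t \<and> R 4 = 2 ^ t \<and> R 5 = (2 ^ t) ^ 3 \<and>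
     R 6 = (2 ^ t) ^ 8 \<and> R 20 = 0"

text \<open>The contract of a loop body that reads one item. The output is a list of words because
  register 9 counts items while the output pointer advances by cells.\<close>

definition item_spec :: "nat \<Rightarrow> nat \<Rightarrow> ram \<Rightarrow> nat \<Rightarrow> nat list \<Rightarrow> nat list list \<Rightarrow> bool" where
  "item_spec t L c \<tau> iw ow \<longleftrightarrow> (\<forall>R m k. env t L R \<longrightarrow> holds m (R 7) iw \<longrightarrow>
     wp c (\<lambda>R' m' k'. env t L R' \<and> R' 7 = R 7 + length iw \<and> R' 8 = R 8 + length (concat ow) \<and>
       R' 9 = R 9 + length ow \<and> R' 10 = R 10 \<and> R' 11 = R 11 \<and>
       m' = fill m (R 8) (concat ow) \<and> k' \<le> k + \<tau>) R m k)"

definition Section :: "ram \<Rightarrow> ram" where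
  "Section c = block [Add 10 8 20, Add 8 8 2, Const 9 0, Load 11 7, Add 7 7 2,
     While 11 (Seq c (Sub 11 11 2)), Store 10 9]"

text \<open>How many items come out is known only at the end, so the header cell is skipped first
  and stored last. Each round adds the loop test and the decrement to the cost of the item.\<close>

lemma wp_Section:
  assumes item: "\<And>d. d \<in> set ds \<Longrightarrow> item_spec t L c \<tau> (iw d) (ow d)"
    and R: "env t L R" "holds m (R 7) (length ds # concat (map iw ds))"
      "R 7 + Suc (length (concat (map iw ds))) \<le> R 8"
    and out: "out = length (concat (map ow ds)) # concat (concat (map ow ds))"
  shows "wp (Section c) (\<lambda>R' m' k'. env t L R' \<and> R' 7 = R 7 + Suc (length (concat (map iw ds))) \<and>
    R' 8 = R 8 + length out \<and> m' = fill m (R 8) out \<and> k' \<le> k + (\<tau> + 2) * length ds + 7) R m k"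
proof -
  let ?in = "\<lambda>i. concat (map iw (take i ds))" and ?out = "\<lambda>i. concat (map ow (take i ds))"
  let ?I = "\<lambda>j R' m' k'. \<exists>i. i + j = length ds \<and> env t L R' \<and> R' 7 = Suc (R 7) + length (?in i) \<and>
    R' 8 = Suc (R 8) + length (concat (?out i)) \<and> R' 9 = length (?out i) \<and> R' 10 = R 8 \<and>
    R' 11 = j \<and> m' = fill m (Suc (R 8)) (concat (?out i)) \<and> k' \<le> k + 5 + (\<tau> + 2) * i"
  let ?R = "R(10 := R 8, 8 := Suc (R 8), 9 := 0, 11 := length ds, 7 := Suc (R 7))"
  have "wp (While 11 (Seq c (Sub 11 11 2))) (wp (Store 10 9) (\<lambda>R' m' k'. env t L R' \<and>
    R' 7 = R 7 + Suc (length (concat (map iw ds))) \<and>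
    R' 8 = R 8 + length out \<and> m' = fill m (R 8) out \<and> k' \<le> k + (\<tau> + 2) * length ds + 7))
    ?R m (Suc (Suc (Suc (Suc (Suc k)))))"
  proof (rule wp_While[where I = ?I and n = "length ds"])
    show "?I (length ds) ?R m (Suc (Suc (Suc (Suc (Suc k)))))"
      using R(1) by (intro exI[of _ 0]) (simp add: env_def)
  next
    fix j R' m' k'
    assume "?I (Suc j) R' m' k'"
    then obtain i where i: "i + Suc j = length ds" and R': "env t L R'" "R' 7 = Suc (R 7) + length (?in i)"
      "R' 8 = Suc (R 8) + length (concat (?out i))" "R' 9 = length (?out i)" "R' 10 = R 8"
      "R' 11 = Suc j" and m': "m' = fill m (Suc (R 8)) (concat (?out i))"
      and k': "k' \<le> k + 5 + (\<tau> + 2) * i"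
      by blast
    let ?d = "ds ! i"
    have take: "take (Suc i) ds = take i ds @ [?d]"
      using i by (simp add: take_Suc_conv_app_nth)
    have ds: "ds = take i ds @ ?d # drop (Suc i) ds"
      using i by (simp add: id_take_nth_drop)
    have "concat (map iw ds) = ?in i @ iw ?d @ concat (map iw (drop (Suc i) ds))"
      by (subst ds) simp
    then have "holds m (R' 7) (iw ?d)" "R' 7 + length (iw ?d) \<le> R 8"
      using R(2,3) R'(2) by simp_all
    then have "holds m' (R' 7) (iw ?d)"
      unfolding m' by (subst holds_fill) auto
    moreover have "item_spec t L c \<tau> (iw ?d) (ow ?d)"
      using i by (intro item) simp
    ultimately have "wp c (\<lambda>R'' m'' k''. env t L R'' \<and> R'' 7 = R' 7 + length (iw ?d) \<and>
        R'' 8 = R' 8 + length (concat (ow ?d)) \<and> R'' 9 = R' 9 + length (ow ?d) \<and> R'' 10 = R' 10 \<and>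
        R'' 11 = R' 11 \<and> m'' = fill m' (R' 8) (concat (ow ?d)) \<and> k'' \<le> Suc k' + \<tau>) R' m' (Suc k')"
      using R'(1) unfolding item_spec_def by blast
    then show "wp (Seq c (Sub 11 11 2)) (?I j) R' m' (Suc k')"
      unfolding wp_Seq
    proof (rule wp_mono, elim conjE)
      fix R'' m'' k''
      assume *: "env t L R''" "R'' 7 = R' 7 + length (iw ?d)"
        "R'' 8 = R' 8 + length (concat (ow ?d))" "R'' 9 = R' 9 + length (ow ?d)" "R'' 10 = R' 10"
        "R'' 11 = R' 11" "m'' = fill m' (R' 8) (concat (ow ?d))" "k'' \<le> Suc k' + \<tau>"
      have "?I j (R''(11 := R'' 11 - R'' 2)) m'' (Suc k'')"
        using i * R' k' by (intro exI[of _ "Suc i"]) (simp add: take env_def m' fill_append)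
      then show "wp (Sub 11 11 2) (?I j) R'' m'' k''" by simp
    qed
  next
    fix R' m' k'
    assume "?I 0 R' m' k'"
    then show "wp (Store 10 9) (\<lambda>R' m' k'. env t L R' \<and>
        R' 7 = R 7 + Suc (length (concat (map iw ds))) \<and>
        R' 8 = R 8 + length out \<and> m' = fill m (R 8) out \<and> k' \<le> k + (\<tau> + 2) * length ds + 7) R' m' (Suc k')"
      by (auto simp: out fill_upd)
  qed auto
  moreover have "m (R 7) = length ds" using R(2) by simp
  ultimately show ?thesis
    using R(1) by (simp add: Section_def env_def)
qed

section \<open>Listing the states and the transitions\<close>

definition State_Item :: ram where
  "State_Item = block [Load 12 7, Add 7 7 2, Double 12, Double 12, Double 12, Add 19 5 20,
     While 19 (block [Store 8 12, Add 8 8 2, Add 12 12 2, Add 9 9 2, Sub 19 19 2])]"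

text \<open>The codes over \<open>q\<close> are \<open>M ^ 3\<close> consecutive numbers, so
  incrementing lists them all. Finality depends on \<open>q\<close> alone, hence the same loop body
  serves the final states.\<close>

definition state_codes :: "nat \<Rightarrow> nat \<Rightarrow> nat list" where
  "state_codes t q = map (\<lambda>i. q * (2 ^ t) ^ 3 + i) [0..<(2 ^ t) ^ 3]"

lemma State_Item_spec:
  "item_spec t L State_Item (9 * t + 6 * (2 ^ t) ^ 3 + 10) [q] (map (\<lambda>p. [p]) (state_codes t q))"
  unfolding item_spec_def
proof (intro allI impI)
  fix R m k
  assume R: "env t L R" "holds m (R 7) [q]"
  let ?M = "(2 :: nat) ^ t" and ?P = "\<lambda>i. map (\<lambda>i. q * (2 ^ t) ^ 3 + i) [0..<i]"
  let ?Q = "\<lambda>R' m' k'. env t L R' \<and> R' 7 = R 7 + length [q] \<and>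
    R' 8 = R 8 + length (concat (map (\<lambda>p. [p]) (state_codes t q))) \<and>
    R' 9 = R 9 + length (map (\<lambda>p. [p]) (state_codes t q)) \<and> R' 10 = R 10 \<and> R' 11 = R 11 \<and>
    m' = fill m (R 8) (concat (map (\<lambda>p. [p]) (state_codes t q))) \<and> k' \<le> k + (9 * t + 6 * ?M ^ 3 + 10)"
  let ?I = "\<lambda>j R' m' k'. \<exists>i. i + j = ?M ^ 3 \<and> env t L R' \<and> R' 7 = Suc (R 7) \<and> R' 8 = R 8 + i \<and>
    R' 9 = R 9 + i \<and> R' 10 = R 10 \<and> R' 11 = R 11 \<and> R' 12 = q * ?M ^ 3 + i \<and> R' 19 = j \<and>
    m' = fill m (R 8) (?P i) \<and> k' \<le> k + 9 * t + 9 + 6 * i"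
  have "wp (While 19 (block [Store 8 12, Add 8 8 2, Add 12 12 2, Add 9 9 2, Sub 19 19 2])) ?Q
    (R(7 := Suc (R 7), 12 := q * ?M * ?M * ?M, 32 := 0, 19 := ?M ^ 3)) m k'"
    if "k' \<le> k + 9 * t + 9" for k'
  proof (rule wp_While[where I = ?I and n = "?M ^ 3"])
    show "?I (?M ^ 3) (R(7 := Suc (R 7), 12 := q * ?M * ?M * ?M, 32 := 0, 19 := ?M ^ 3)) m k'"
      using R(1) that by (intro exI[of _ 0]) (simp add: env_def power3_eq_cube)
  next
    fix j R' m' k'
    assume "?I (Suc j) R' m' k'"
    then obtain i where *: "i + Suc j = ?M ^ 3" "env t L R'" "R' 7 = Suc (R 7)" "R' 8 = R 8 + i"
      "R' 9 = R 9 + i" "R' 10 = R 10" "R' 11 = R 11" "R' 12 = q * ?M ^ 3 + i" "R' 19 = Suc j"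
      "m' = fill m (R 8) (?P i)" "k' \<le> k + 9 * t + 9 + 6 * i"
      by blast
    moreover from *(2) have "R' 2 = 1" by (simp add: env_def)
    ultimately show "wp (block [Store 8 12, Add 8 8 2, Add 12 12 2, Add 9 9 2, Sub 19 19 2]) (?I j) R' m' (Suc k')"
      by (simp add: env_def fill_append)
  next
    fix R' m' k'
    assume "?I 0 R' m' k'"
    then show "?Q R' m' (Suc k')"
      by (auto simp: state_codes_def comp_def)
  qed auto
  then show "wp State_Item ?Q R m k"
    using R unfolding State_Item_def env_def
    by (auto intro!: wp_Double simp: env_def fun_upd_twist)
qed

definition Transition_Loop :: ram where
  "Transition_Loop = While 19 (block [Step, Add 18 18 2, Sub 19 19 2])"

definition Transition_Item :: ram where
  "Transition_Item = block [Load 13 7, Add 7 7 2, Const 14 0, Const 15 0,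
     If 13
       (block [Load 14 7, Add 7 7 2, Sub 51 13 2,
          If 51 (block [Load 15 7, Add 7 7 2]) (Const 51 0)])
       (Const 51 0),
     Load 16 7, Add 7 7 2, Load 17 7, Add 7 7 2, Load 12 7, Add 7 7 2,
     Const 18 0, Add 19 6 20, Transition_Loop]"

text \<open>The appended zeros are the values that registers 14 and 15 keep when a child is absent;
  \<open>sub_word\<close> drops the codes made from them.\<close>

definition sub_words :: "nat \<Rightarrow> nat list \<Rightarrow> nat \<Rightarrow> nat \<Rightarrow> nat \<Rightarrow> nat list list" where
  "sub_words t qs x' y' q = concat (map (emitted t (length qs) ((qs @ [0, 0]) ! 0) ((qs @ [0, 0]) ! 1) x' y' q)
     [0..<(2 ^ t) ^ 8])"

lemma wp_Transition_loop:
  assumes R: "env t L R" "R 13 = length qs" "R 14 = (qs @ [0, 0]) ! 0" "R 15 = (qs @ [0, 0]) ! 1"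
    "R 16 = x'" "R 17 = y'" "R 12 = q" "length qs \<le> 2" "x' < 2 ^ t" "R 18 = 0" "R 19 = (2 ^ t) ^ 8"
  shows "wp Transition_Loop
    (\<lambda>R' m' k'. env t L R' \<and> R' 7 = R 7 \<and> R' 8 = R 8 + length (concat (sub_words t qs x' y' q)) \<and>
       R' 9 = R 9 + length (sub_words t qs x' y' q) \<and> R' 10 = R 10 \<and> R' 11 = R 11 \<and>
       m' = fill m (R 8) (concat (sub_words t qs x' y' q)) \<and>
       k' \<le> k + ((186 * t + 115) * (2 ^ t) ^ 8 + 1)) R m k"
proof -
  let ?N = "((2 :: nat) ^ t) ^ 8"
  let ?e = "emitted t (length qs) ((qs @ [0, 0]) ! 0) ((qs @ [0, 0]) ! 1) x' y' q"
  let ?P = "\<lambda>i. concat (map ?e [0..<i])"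
  let ?F = "\<lambda>R'. \<forall>r < 21. r \<notin> {8, 9, 18, 19} \<longrightarrow> R' r = R r"
  let ?I = "\<lambda>j R' m' k'. \<exists>i. i + j = ?N \<and> ?F R' \<and> R' 18 = i \<and> R' 19 = j \<and>
    R' 8 = R 8 + length (concat (?P i)) \<and> R' 9 = R 9 + length (?P i) \<and>
    m' = fill m (R 8) (concat (?P i)) \<and> k' \<le> k + (186 * t + 115) * i"
  show ?thesis
    unfolding Transition_Loop_def
  proof (rule wp_While[where I = ?I and n = ?N])
    show "?I ?N R m k"
      using R by (intro exI[of _ 0]) simp
  next
    fix j R' m' k'
    assume "?I (Suc j) R' m' k'"
    then obtain i where i: "i + Suc j = ?N" and F: "?F R'" and *: "R' 18 = i" "R' 19 = Suc j"
      "R' 8 = R 8 + length (concat (?P i))" "R' 9 = R 9 + length (?P i)"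
      "m' = fill m (R 8) (concat (?P i))" "k' \<le> k + (186 * t + 115) * i"
      by blast
    show "wp (block [Step, Add 18 18 2, Sub 19 19 2]) (?I j) R' m' (Suc k')"
      unfolding block.simps wp_Seq
    proof (rule wp_mono[OF wp_Step[where t = t and w = "?e i"]])
      fix R'' m'' k''
      assume **: "(\<forall>r < 21. r \<notin> {8, 9} \<longrightarrow> R'' r = R' r) \<and> R'' 8 = R' 8 + length (concat (?e i)) \<and>
        R'' 9 = R' 9 + length (?e i) \<and> m'' = fill m' (R' 8) (concat (?e i)) \<and>
        k'' \<le> Suc k' + (186 * t + 112)"
      then have [simp]: "R'' 2 = 1" "R'' 18 = i" "R'' 19 = Suc j"
        using F R(1) * by (auto simp: env_def)
      have "?I j (R''(18 := R'' 18 + R'' 2, 19 := R'' 19 - R'' 2)) m'' (Suc (Suc k''))"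
        using R(1) i F * ** by (intro exI[of _ "Suc i"]) (auto simp: env_def fill_append)
      then show "wp (Add 18 18 2) (wp (Sub 19 19 2) (?I j)) R'' m'' k''"
        by simp
    qed (use R F * i in \<open>auto simp: env_def\<close>)
  next
    fix R' m' k'
    assume "?I 0 R' m' k'"
    then show "env t L R' \<and> R' 7 = R 7 \<and> R' 8 = R 8 + length (concat (sub_words t qs x' y' q)) \<and>
       R' 9 = R 9 + length (sub_words t qs x' y' q) \<and> R' 10 = R 10 \<and> R' 11 = R 11 \<and>
       m' = fill m (R 8) (concat (sub_words t qs x' y' q)) \<and>
       Suc k' \<le> k + ((186 * t + 115) * (2 ^ t) ^ 8 + 1)"
      using R(1) by (auto simp: env_def sub_words_def)
  qed auto
qed

lemma Transition_Item_spec: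
  assumes "length qs \<le> 2" "x' < 2 ^ t"
  shows "item_spec t L Transition_Item ((186 * t + 115) * (2 ^ t) ^ 8 + 24)
    (length qs # qs @ [x', y', q]) (sub_words t qs x' y' q)"
  unfolding item_spec_def
proof (intro allI impI)
  fix R m k
  assume R: "env t L R" "holds m (R 7) (length qs # qs @ [x', y', q])"
  let ?Q = "\<lambda>R' m' k'. env t L R' \<and> R' 7 = R 7 + length (length qs # qs @ [x', y', q]) \<and>
    R' 8 = R 8 + length (concat (sub_words t qs x' y' q)) \<and>
    R' 9 = R 9 + length (sub_words t qs x' y' q) \<and> R' 10 = R 10 \<and> R' 11 = R 11 \<and>
    m' = fill m (R 8) (concat (sub_words t qs x' y' q)) \<and>
    k' \<le> k + ((186 * t + 115) * (2 ^ t) ^ 8 + 24)"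
  let ?pre = "\<lambda>R'. env t L R' \<and> R' 13 = length qs \<and> R' 14 = (qs @ [0, 0]) ! 0 \<and>
    R' 15 = (qs @ [0, 0]) ! 1 \<and> R' 16 = x' \<and> R' 17 = y' \<and> R' 12 = q \<and> R' 18 = 0 \<and>
    R' 19 = (2 ^ t) ^ 8 \<and> R' 7 = R 7 + length qs + 4 \<and> R' 8 = R 8 \<and> R' 9 = R 9 \<and>
    R' 10 = R 10 \<and> R' 11 = R 11"
  have R2: "R 2 = 1" using R(1) by (simp add: env_def)
  \<comment> \<open>The postcondition \<open>Q\<close> is left general so that simplifying the
    straight-line code for the three arities does not touch it.\<close>
  have item: "wp Transition_Item Q R m k"
    if loop: "\<And>R' k'. ?pre R' \<Longrightarrow> k' \<le> k + 23 \<Longrightarrow> wp Transition_Loop Q R' m k'" for Q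
  proof -
    consider "qs = []" | q1 where "qs = [q1]" | q1 q2 where "qs = [q1, q2]"
      using assms(1) by (auto simp: le_Suc_eq length_Suc_conv numeral_2_eq_2)
    then show ?thesis
      by cases (use R R2 in \<open>simp_all add: Transition_Item_def\<close>, (rule loop; simp add: env_def)+)
  qed
  show "wp Transition_Item ?Q R m k"
  proof (rule item)
    fix R' k'
    assume R': "?pre R'" and "k' \<le> k + 23"
    then show "wp Transition_Loop ?Q R' m k'"
      by (intro wp_mono[OF wp_Transition_loop[of t L R' qs x' y' q]]) (use assms in auto)
  qed
qed

section \<open>Set-up and total running time\<close>

definition Prelude :: ram where
  "Prelude = block [Const 2 1, Load 3 7, Add 7 7 2, Const 4 1, Double 4,
     Add 5 4 20, Double 5, Double 5, Add 6 5 20, Double 6, Double 6, Double 6, Double 6, Double 6,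
     Add 8 0 20, Store 8 3, Add 8 8 2]"

text \<open>One \<open>Double\<close> gives \<open>M\<close>, two more \<open>M ^ 3\<close>, and
  five more \<open>M ^ 8\<close>; these eight cost \<open>24 * t + 16\<close>. The output starts
  with \<open>t\<close> directly behind the input.\<close>

lemma wp_Prelude:
  assumes R: "R = (\<lambda>_. 0)(0 := L)" and m: "m 0 = t"
    and Q: "\<And>R' k'. env t L R' \<Longrightarrow> R' 7 = 1 \<Longrightarrow> R' 8 = Suc L \<Longrightarrow> k' = k + (24 * t + 25) \<Longrightarrow>
      Q R' (m(L := t)) k'"
  shows "wp Prelude Q R m k"
proof -
  have p3: "2 ^ t * 2 ^ t * 2 ^ t = ((2 :: nat) ^ t) ^ 3"
    by (simp add: power3_eq_cube)
  have p8: "(2 ^ t) ^ 3 * 2 ^ t * 2 ^ t * 2 ^ t * 2 ^ t * 2 ^ t = ((2 :: nat) ^ t) ^ 8"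
    by (simp add: numeral_eq_Suc mult.assoc)
  show ?thesis
    unfolding Prelude_def R
    apply (simp add: m)
    apply (rule wp_Double, simp, simp, simp, simp)
    apply (rule wp_Double, simp, simp, simp, simp)
    apply (rule wp_Double, simp, simp, simp, simp add: p3)
    apply (rule wp_Double, simp, simp, simp, simp)
    apply (rule wp_Double, simp, simp, simp, simp)
    apply (rule wp_Double, simp, simp, simp, simp)
    apply (rule wp_Double, simp, simp, simp, simp)
    apply (rule wp_Double, simp, simp, simp, simp add: p8)
    apply (rule Q)
       apply (simp_all add: env_def)
    done
qed

definition Sub_Program :: ram where
  "Sub_Program = block [Prelude, Section State_Item, Section State_Item, Section Transition_Item]"

type_synonym num_trans = "nat list \<times> nat \<times> nat \<times> nat"

fun num_word :: "num_trans \<Rightarrow> nat list" where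
  "num_word (qs, x, y, q) = length qs # qs @ [x, y, q]"

fun num_sub :: "nat \<Rightarrow> num_trans \<Rightarrow> nat list list" where
  "num_sub t (qs, x, y, q) = sub_words t qs x y q"

definition num_output :: "nat \<Rightarrow> nat list \<Rightarrow> nat list \<Rightarrow> num_trans list \<Rightarrow> nat list" where
  "num_output t qs fs ds = (let Q = concat (map (state_codes t) qs); F = concat (map (state_codes t) fs);
     D = concat (map (num_sub t) ds)
   in [t] @ (length Q # Q) @ (length F # F) @ (length D # concat D))"

text \<open>Three sections run one after the other, each starting where the last one stopped reading
  and writing. The constant 46 is 25 for the prelude and 7 per section.\<close>

lemma Sub_Program_computes:
  assumes xs: "xs = [t] @ (length qs # qs) @ (length fs # fs) @ (length ds # concat (map num_word ds))"
    and ds: "\<And>ps x y q. (ps, x, y, q) \<in> set ds \<Longrightarrow> length ps \<le> 2 \<and> x < 2 ^ t"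
  shows "\<exists>n. computes_in Sub_Program xs n (num_output t qs fs ds) \<and>
    n \<le> 24 * t + 46 + (9 * t + 6 * (2 ^ t) ^ 3 + 12) * (length qs + length fs) +
      ((186 * t + 115) * (2 ^ t) ^ 8 + 26) * length ds"
proof -
  define L where "L = length xs"
  define m0 where "m0 = (\<lambda>i. if i < L then xs ! i else 0)"
  let ?\<tau>s = "9 * t + 6 * (2 ^ t) ^ 3 + 10" and ?\<tau>t = "(186 * t + 115) * (2 ^ t) ^ 8 + 24"
  let ?ow = "\<lambda>q. map (\<lambda>p. [p]) (state_codes t q)"
  let ?Q = "concat (map (state_codes t) qs)" and ?F = "concat (map (state_codes t) fs)"
  let ?D = "concat (map (num_sub t) ds)"
  define oQ oF oD where "oQ = length ?Q # ?Q" and "oF = length ?F # ?F" and "oD = length ?D # concat ?D"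
  \<comment> \<open>Each state item is a word of a single cell, so counting items and counting cells
    agree.\<close>
  have out: "length (concat (map ?ow ps)) # concat (concat (map ?ow ps)) =
      length (concat (map (state_codes t) ps)) # concat (map (state_codes t) ps)" for ps
    by (induction ps) (simp_all add: comp_def)
  have iw: "concat (map (\<lambda>q. [q]) ps) = ps" for ps :: "nat list"
    by (induction ps) simp_all
  have "holds m0 0 xs" by (simp add: holds_def m0_def L_def)
  then have m0: "m0 0 = t" "holds m0 1 (length qs # qs)"
    "holds m0 (2 + length qs) (length fs # fs)"
    "holds m0 (3 + length qs + length fs) (length ds # concat (map num_word ds))"
    by (simp_all add: xs numeral_eq_Suc)
  have L: "L = 4 + length qs + length fs + length (concat (map num_word ds))"
    by (simp add: L_def xs)
  have Transition_Item: "item_spec t L Transition_Item ?\<tau>t (num_word d) (num_sub t d)" if "d \<in> set ds" for d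
  proof (cases d)
    case (fields ps x y q)
    then show ?thesis
      using ds[of ps x y q] that Transition_Item_spec[of ps x t L y q] by simp
  qed
  have "wp Sub_Program (\<lambda>R m k. R 0 = L \<and> m = fill m0 L (num_output t qs fs ds) \<and>
    k \<le> 24 * t + 25 + ((?\<tau>s + 2) * length qs + 7) + ((?\<tau>s + 2) * length fs + 7) +
      ((?\<tau>t + 2) * length ds + 7)) ((\<lambda>_. 0)(0 := L)) m0 0"
    unfolding Sub_Program_def block.simps wp_Seq
  proof (rule wp_Prelude[where L = L and m = m0 and t = t, OF refl m0(1)])
    fix R1 k1
    assume R1: "env t L R1" "R1 7 = 1" "R1 8 = Suc L" and k1: "k1 = 0 + (24 * t + 25)"
    define m1 where "m1 = fill m0 L [t]"
    have "holds m1 (R1 7) (length qs # concat (map (\<lambda>q. [q]) qs))"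
      unfolding R1 iw m1_def by (subst holds_fill) (use m0(2) L in auto)
    then have *: "wp (Section State_Item) (\<lambda>R2 m2 k2. env t L R2 \<and> R2 7 = R1 7 + Suc (length (concat (map (\<lambda>q. [q]) qs))) \<and>
      R2 8 = R1 8 + length oQ \<and> m2 = fill m1 (R1 8) oQ \<and> k2 \<le> k1 + (?\<tau>s + 2) * length qs + 7) R1 m1 k1"
      by (intro wp_Section[OF State_Item_spec]) (use R1 L in \<open>simp_all add: out iw oQ_def\<close>)
    have "wp (Section State_Item) (wp (Section State_Item) (wp (Section Transition_Item) 
      (\<lambda>R m k. R 0 = L \<and> m = fill m0 L (num_output t qs fs ds) \<and>
    k \<le> 24 * t + 25 + ((?\<tau>s + 2) * length qs + 7) + ((?\<tau>s + 2) * length fs + 7) +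
      ((?\<tau>t + 2) * length ds + 7)))) R1 m1 k1"
    proof (rule wp_mono[OF *], elim conjE)
      fix R2 m2 k2
      assume R2: "env t L R2" "R2 7 = R1 7 + Suc (length (concat (map (\<lambda>q. [q]) qs)))"
        "R2 8 = R1 8 + length oQ" "m2 = fill m1 (R1 8) oQ" and k2: "k2 \<le> k1 + (?\<tau>s + 2) * length qs + 7"
      have m2: "m2 = fill m0 L ([t] @ oQ)" using R1 R2 by (simp add: m1_def)
      have R2': "R2 7 = 2 + length qs" "R2 8 = L + length ([t] @ oQ)" using R1 R2 by (simp_all add: iw)
      have "holds m2 (R2 7) (length fs # concat (map (\<lambda>q. [q]) fs))"
        unfolding R2' iw m2 by (subst holds_fill) (use m0(3) L in auto)
      then have *: "wp (Section State_Item) (\<lambda>R3 m3 k3. env t L R3 \<and> R3 7 = R2 7 + Suc (length (concat (map (\<lambda>q. [q]) fs))) \<and>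
        R3 8 = R2 8 + length oF \<and> m3 = fill m2 (R2 8) oF \<and> k3 \<le> k2 + (?\<tau>s + 2) * length fs + 7) R2 m2 k2"
        by (intro wp_Section[OF State_Item_spec]) (use R2(1) R2' L in \<open>simp_all add: out iw oF_def\<close>)
      show "wp (Section State_Item) (wp (Section Transition_Item) 
        (\<lambda>R m k. R 0 = L \<and> m = fill m0 L (num_output t qs fs ds) \<and>
        k \<le> 24 * t + 25 + ((?\<tau>s + 2) * length qs + 7) + ((?\<tau>s + 2) * length fs + 7) +
        ((?\<tau>t + 2) * length ds + 7))) R2 m2 k2"
      proof (rule wp_mono[OF *], elim conjE)
        fix R3 m3 k3
        assume R3: "env t L R3" "R3 7 = R2 7 + Suc (length (concat (map (\<lambda>q. [q]) fs)))"
          "R3 8 = R2 8 + length oF" "m3 = fill m2 (R2 8) oF" and k3: "k3 \<le> k2 + (?\<tau>s + 2) * length fs + 7"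
        have m3: "m3 = fill m0 L ([t] @ oQ @ oF)"
          using R2' R3(4) by (simp only: m2 fill_append append_assoc[symmetric])
        have R3': "R3 7 = 3 + length qs + length fs" "R3 8 = L + length ([t] @ oQ @ oF)"
          using R2' R3 by (simp_all add: iw)
        have "holds m3 (R3 7) (length ds # concat (map num_word ds))"
          unfolding R3' m3 by (subst holds_fill) (use m0(4) L in auto)
        then have *: "wp (Section Transition_Item) (\<lambda>R4 m4 k4. env t L R4 \<and>
          R4 7 = R3 7 + Suc (length (concat (map num_word ds))) \<and>
          R4 8 = R3 8 + length oD \<and> m4 = fill m3 (R3 8) oD \<and> k4 \<le> k3 + (?\<tau>t + 2) * length ds + 7) R3 m3 k3"
          by (intro wp_Section[OF Transition_Item]) (use R3(1) R3' L in \<open>simp_all add: oD_def\<close>)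
        have fin: "fill m3 (R3 8) oD = fill m0 L (num_output t qs fs ds)"
          unfolding R3' m3 num_output_def Let_def oQ_def[symmetric] oF_def[symmetric] oD_def[symmetric]
          by (simp only: fill_append append_assoc[symmetric])
        show "wp (Section Transition_Item) 
          (\<lambda>R m k. R 0 = L \<and> m = fill m0 L (num_output t qs fs ds) \<and>
          k \<le> 24 * t + 25 + ((?\<tau>s + 2) * length qs + 7) + ((?\<tau>s + 2) * length fs + 7) +
          ((?\<tau>t + 2) * length ds + 7)) R3 m3 k3"
          by (rule wp_mono[OF *]) (use k1 k2 k3 fin in \<open>auto simp: env_def\<close>)
      qed
    qed
    then show "wp (Section State_Item) (wp (Section State_Item) (wp (Section Transition_Item) 
      (\<lambda>R m k. R 0 = L \<and> m = fill m0 L (num_output t qs fs ds) \<and>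
    k \<le> 24 * t + 25 + ((?\<tau>s + 2) * length qs + 7) + ((?\<tau>s + 2) * length fs + 7) +
      ((?\<tau>t + 2) * length ds + 7)))) R1 (m0(L := t)) k1"
      by (simp add: m1_def)
  qed
  then obtain n s where "exec Sub_Program \<lparr>reg = (\<lambda>_. 0)(0 := L), mem = m0\<rparr> n s" "reg s 0 = L"
    "mem s = fill m0 L (num_output t qs fs ds)"
    "n \<le> 24 * t + 25 + ((?\<tau>s + 2) * length qs + 7) + ((?\<tau>s + 2) * length fs + 7) +
      ((?\<tau>t + 2) * length ds + 7)"
    unfolding wp_def by auto
  moreover have "initial xs = \<lparr>reg = (\<lambda>_. 0)(0 := L), mem = m0\<rparr>"
    by (simp add: initial_def m0_def L_def)
  ultimately have "computes_in Sub_Program xs n (num_output t qs fs ds)"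
    unfolding computes_in_def has_output_def by (metis fill_inside)
  moreover have "n \<le> 24 * t + 46 + (9 * t + 6 * (2 ^ t) ^ 3 + 12) * (length qs + length fs) +
      ((186 * t + 115) * (2 ^ t) ^ 8 + 26) * length ds"
    using \<open>n \<le> _\<close> by (simp add: algebra_simps)
  ultimately show ?thesis by blast
qed

section \<open>Sub-decompositions by recursion on terms\<close>

definition consistent :: "nat \<Rightarrow> bag \<Rightarrow> bag \<Rightarrow> bag \<Rightarrow> bag \<Rightarrow> bool" where
  "consistent t a a' c c' \<longleftrightarrow>
     (\<forall>s \<in> {1..t}. s \<in> fst a' \<longrightarrow> s \<in> fst c' \<longrightarrow> (s \<notin> fst a \<longleftrightarrow> s \<notin> fst c))"

text \<open>A position-free form of \<open>sub_decomposition\<close>: equal position sets mean equal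
  shapes, and (S3) is local to edges, so it can follow the recursion.\<close>

fun sub_term :: "nat \<Rightarrow> bag trm \<Rightarrow> bag trm \<Rightarrow> bool" where
  "sub_term t (Nullary a) (Nullary a') = sub_bag a a'"
| "sub_term t (Unary a u) (Unary a' u') =
     (sub_bag a a' \<and> consistent t a a' (root u) (root u') \<and> sub_term t u u')"
| "sub_term t (Binary a u v) (Binary a' u' v') =
     (sub_bag a a' \<and> consistent t a a' (root u) (root u') \<and> consistent t a a' (root v) (root v') \<and>
      sub_term t u u' \<and> sub_term t v v')"
| "sub_term t _ _ = False"

lemma Nil_in_Pos [simp]: "[] \<in> Pos T"
  by (cases T) auto

text \<open>An edge either leaves the root or lies inside the argument with a prefixed 1. The
  relation \<open>P\<close> is arbitrary so that it can be instantiated with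
  \<open>consistent\<close> at both ends of an edge.\<close>

lemma Pos_edges_Unary:
  "(\<forall>p j. p \<in> Pos (Unary a u) \<longrightarrow> p @ [j] \<in> Pos (Unary a u) \<longrightarrow> P p (p @ [j])) \<longleftrightarrow>
   P [] [1] \<and> (\<forall>p j. p \<in> Pos u \<longrightarrow> p @ [j] \<in> Pos u \<longrightarrow> P (1 # p) (1 # p @ [j]))" (is "?L \<longleftrightarrow> ?R")
proof
  assume L: ?L
  have "P [] [1]" using L[rule_format, of "[]" 1] by simp
  moreover have "P (1 # p) (1 # p @ [j])" if "p \<in> Pos u" "p @ [j] \<in> Pos u" for p j
    using L[rule_format, of "1 # p" j] that by simp
  ultimately show ?R by blast
next
  assume R: ?R
  have "P p (p @ [j])" if "p \<in> Pos (Unary a u)" "p @ [j] \<in> Pos (Unary a u)" for p j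
    using R that by (cases p) auto
  then show ?L by blast
qed

lemma Pos_edges_Binary:
  "(\<forall>p j. p \<in> Pos (Binary a u v) \<longrightarrow> p @ [j] \<in> Pos (Binary a u v) \<longrightarrow> P p (p @ [j])) \<longleftrightarrow>
   P [] [1] \<and> P [] [2] \<and> (\<forall>p j. p \<in> Pos u \<longrightarrow> p @ [j] \<in> Pos u \<longrightarrow> P (1 # p) (1 # p @ [j])) \<and>
   (\<forall>p j. p \<in> Pos v \<longrightarrow> p @ [j] \<in> Pos v \<longrightarrow> P (2 # p) (2 # p @ [j]))" (is "?L \<longleftrightarrow> ?R")
proof
  assume L: ?L
  have "P [] [1]" "P [] [2]" using L[rule_format, of "[]" 1] L[rule_format, of "[]" 2] by simp_all
  moreover have "P (1 # p) (1 # p @ [j])" if "p \<in> Pos u" "p @ [j] \<in> Pos u" for p j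
    using L[rule_format, of "1 # p" j] that by simp
  moreover have "P (2 # p) (2 # p @ [j])" if "p \<in> Pos v" "p @ [j] \<in> Pos v" for p j
    using L[rule_format, of "2 # p" j] that by simp
  ultimately show ?R by blast
next
  assume R: ?R
  have "P p (p @ [j])" if "p \<in> Pos (Binary a u v)" "p @ [j] \<in> Pos (Binary a u v)" for p j
    using R that by (cases p) auto
  then show ?L by blast
qed

lemma Pos_Unary_eq: "Pos (Unary a u) = Pos (Unary a' u') \<longleftrightarrow> Pos u = Pos u'"
proof
  assume eq: "Pos (Unary a u) = Pos (Unary a' u')"
  have "p \<in> Pos u \<longleftrightarrow> p \<in> Pos u'" for p
    using arg_cong[OF eq, of "\<lambda>A. 1 # p \<in> A"] by auto
  then show "Pos u = Pos u'" by blast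
qed simp

lemma Pos_Binary_eq:
  "Pos (Binary a u v) = Pos (Binary a' u' v') \<longleftrightarrow> Pos u = Pos u' \<and> Pos v = Pos v'"
proof
  assume eq: "Pos (Binary a u v) = Pos (Binary a' u' v')"
  have "p \<in> Pos u \<longleftrightarrow> p \<in> Pos u'" for p
    using arg_cong[OF eq, of "\<lambda>A. 1 # p \<in> A"] by (simp add: image_iff)
  moreover have "p \<in> Pos v \<longleftrightarrow> p \<in> Pos v'" for p
    using arg_cong[OF eq, of "\<lambda>A. 2 # p \<in> A"] by (simp add: image_iff)
  ultimately show "Pos u = Pos u' \<and> Pos v = Pos v'" by blast
qed simp

lemma sub_decomposition_consistent:
  "sub_decomposition t T T' \<longleftrightarrow> Pos T = Pos T' \<and>
     (\<forall>p \<in> Pos T. sub_bag (symbol_at T p) (symbol_at T' p)) \<and>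
     (\<forall>p j. p \<in> Pos T \<longrightarrow> p @ [j] \<in> Pos T \<longrightarrow>
       consistent t (symbol_at T p) (symbol_at T' p) (symbol_at T (p @ [j])) (symbol_at T' (p @ [j])))"
  by (simp only: sub_decomposition_def consistent_def)

lemma sub_decomposition_Unary:
  "sub_decomposition t (Unary a u) (Unary a' u') \<longleftrightarrow>
     sub_bag a a' \<and> consistent t a a' (root u) (root u') \<and> sub_decomposition t u u'"
  unfolding sub_decomposition_consistent Pos_Unary_eq
    Pos_edges_Unary[where P = "\<lambda>p p'. consistent t (symbol_at (Unary a u) p) (symbol_at (Unary a' u') p)
      (symbol_at (Unary a u) p') (symbol_at (Unary a' u') p')"]
  by (simp add: ball_Un conj_ac)

lemma sub_decomposition_Binary:
  "sub_decomposition t (Binary a u v) (Binary a' u' v') \<longleftrightarrow>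
     sub_bag a a' \<and> consistent t a a' (root u) (root u') \<and> consistent t a a' (root v) (root v') \<and>
     sub_decomposition t u u' \<and> sub_decomposition t v v'"
  unfolding sub_decomposition_consistent Pos_Binary_eq
    Pos_edges_Binary[where P = "\<lambda>p p'. consistent t (symbol_at (Binary a u v) p) (symbol_at (Binary a' u' v') p)
      (symbol_at (Binary a u v) p') (symbol_at (Binary a' u' v') p')"]
  by (simp add: ball_Un conj_ac)

text \<open>The positions \<open>[1]\<close> and \<open>[2]\<close> reveal the arity of the root,
  which refutes the cases of differing shape.\<close>

lemma sub_decomposition_children:
  "sub_decomposition t T T' \<Longrightarrow> ([1] \<in> Pos T \<longleftrightarrow> [1] \<in> Pos T') \<and> ([2] \<in> Pos T \<longleftrightarrow> [2] \<in> Pos T')"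
  by (simp add: sub_decomposition_def)

lemma sub_decomposition_iff_sub_term: "sub_decomposition t T T' \<longleftrightarrow> sub_term t T T'"
proof (induction t T T' rule: sub_term.induct)
  case (1 t a a')
  then show ?case by (simp add: sub_decomposition_def)
next
  case (2 t a u a' u')
  then show ?case by (simp add: sub_decomposition_Unary)
next
  case (3 t a u v a' u' v')
  then show ?case by (simp add: sub_decomposition_Binary)
qed (auto dest!: sub_decomposition_children)

section \<open>Masks and codes\<close>

text \<open>The inverse of \<open>mask\<close> between numbers below \<open>2 ^ t\<close> and
  subsets of \<open>{1..t}\<close>.\<close>

definition set_of_mask :: "nat \<Rightarrow> nat \<Rightarrow> nat set" where
  "set_of_mask t n = {s \<in> {1..t}. bit n (s - 1)}"

text \<open>Vertices start at 1 and bits at 0; after shifting by one, \<open>mask\<close> is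
  \<open>set_encode\<close>, whose decoding reads off the bits.\<close>

lemma bit_mask:
  assumes "B \<subseteq> {1..t}"
  shows "bit (mask B) k \<longleftrightarrow> Suc k \<in> B"
proof -
  have inj: "inj_on (\<lambda>i. i - 1) B"
    using assms by (intro inj_onI) (metis atLeastAtMost_iff diff_Suc_1 le_add_diff_inverse plus_1_eq_Suc subsetD)
  have "mask B = set_encode ((\<lambda>i. i - 1) ` B)"
    unfolding Defs.mask_def set_encode_def sum.reindex[OF inj] by (simp add: comp_def)
  then have "set_decode (mask B) = (\<lambda>i. i - 1) ` B"
    using finite_subset[OF assms] by simp
  then have "bit (mask B) k \<longleftrightarrow> k \<in> (\<lambda>i. i - 1) ` B"
    by (simp add: set_decode_def bit_iff_odd set_eq_iff)
  also have "\<dots> \<longleftrightarrow> Suc k \<in> B"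
    using assms by (force simp: image_iff)
  finally show ?thesis .
qed

lemma less_power_iff_bit: "(n :: nat) < 2 ^ t \<longleftrightarrow> (\<forall>k \<ge> t. \<not> bit n k)"
proof -
  have "n < 2 ^ t \<longleftrightarrow> take_bit t n = n" by (simp add: take_bit_nat_eq_self_iff)
  also have "\<dots> \<longleftrightarrow> (\<forall>k \<ge> t. \<not> bit n k)"
    by (simp add: bit_eq_iff[of "take_bit t n" n] bit_take_bit_iff) (metis not_le)
  finally show ?thesis .
qed

lemma mask_less:
  assumes "B \<subseteq> {1..t}"
  shows "mask B < 2 ^ t"
  unfolding less_power_iff_bit bit_mask[OF assms] using assms by auto

lemma set_of_mask_subset: "set_of_mask t n \<subseteq> {1..t}"
  by (auto simp: set_of_mask_def)

lemma mem_set_of_mask: "Suc k \<in> set_of_mask t n \<longleftrightarrow> k < t \<and> bit n k"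
  by (auto simp: set_of_mask_def)

lemma set_of_mask_mask:
  assumes "B \<subseteq> {1..t}"
  shows "set_of_mask t (mask B) = B"
proof (rule set_eqI)
  fix s
  show "s \<in> set_of_mask t (mask B) \<longleftrightarrow> s \<in> B"
    using assms by (cases s) (auto simp: mem_set_of_mask bit_mask[OF assms] set_of_mask_def)
qed

lemma mask_set_of_mask:
  assumes "n < 2 ^ t"
  shows "mask (set_of_mask t n) = n"
proof (rule bit_eqI)
  fix k
  show "bit (mask (set_of_mask t n)) k \<longleftrightarrow> bit n k"
    using assms unfolding bit_mask[OF set_of_mask_subset] mem_set_of_mask less_power_iff_bit
    by (metis not_le)
qed

lemma mask_inject:
  assumes "B \<subseteq> {1..t}" "C \<subseteq> {1..t}"
  shows "mask B = mask C \<longleftrightarrow> B = C"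
  using set_of_mask_mask[OF assms(1)] set_of_mask_mask[OF assms(2)] by metis

lemma mask_empty [simp]: "mask {} = 0"
  by (simp add: Defs.mask_def)

lemma mult_add_inject:
  fixes M :: nat
  assumes "x < M" "y < M"
  shows "a * M + x = b * M + y \<longleftrightarrow> a = b \<and> x = y"
proof
  assume eq: "a * M + x = b * M + y"
  have "(a * M + x) div M = a" "(b * M + y) div M = b" "(a * M + x) mod M = x" "(b * M + y) mod M = y"
    using assms by simp_all
  then show "a = b \<and> x = y" using eq by metis
qed simp

lemma code_inject:
  assumes "x < M" "y < M" "z < M" "x' < M" "y' < M" "z' < M"
  shows "code M q x y z = code M q' x' y' z' \<longleftrightarrow> q = q' \<and> x = x' \<and> y = y' \<and> z = z'"
  unfolding code_def mult_add_inject[OF assms(3,6)] mult_add_inject[OF assms(2,5)]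
    mult_add_inject[OF assms(1,4)] by blast

text \<open>The three sets occupy the three lowest base-\<open>M\<close> digits, so dividing by
  \<open>M ^ 3\<close> recovers the number of the state of \<open>A\<close>.\<close>

lemma code_div:
  assumes "x < M" "y < M" "z < M"
  shows "code M q x y z div M ^ 3 = q"
proof -
  have "code M q x y z div M ^ 3 = code M q x y z div M div M div M"
    by (simp add: power3_eq_cube div_mult2_eq)
  also have "\<dots> = q" using assms by (simp add: code_def)
  finally show ?thesis .
qed

lemma set_state_codes: "p \<in> set (state_codes t q) \<longleftrightarrow> p div (2 ^ t) ^ 3 = q"
proof -
  define K :: nat where "K = (2 ^ t) ^ 3"
  have "K > 0" by (simp add: K_def)
  have "p \<in> set (state_codes t q) \<longleftrightarrow> q * K \<le> p \<and> p < K + q * K"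
    by (auto simp: state_codes_def K_def[symmetric])
  also have "\<dots> \<longleftrightarrow> p div K = q"
    using \<open>K > 0\<close> by (auto simp: div_nat_eqI mult.commute dividend_less_times_div add.commute)
  finally show ?thesis by (simp add: K_def)
qed

text \<open>Blocks of different states are disjoint, since the quotient by \<open>M ^ 3\<close>
  tells them apart.\<close>

lemma distinct_state_codes: "distinct ps \<Longrightarrow> distinct (concat (map (state_codes t) ps))"
proof (induction ps)
  case (Cons p ps)
  moreover have "distinct (state_codes t p)"
    by (simp add: state_codes_def distinct_map inj_on_def)
  ultimately show ?case by (auto simp: set_state_codes)
qed simp

lemma set_concat_state_codes:
  "set (concat (map (state_codes t) ps)) = {p. p div (2 ^ t) ^ 3 \<in> set ps}"
  by (auto simp: set_state_codes)

section \<open>The automaton for sub-decompositions\<close>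

definition padded :: "('q \<Rightarrow> nat) \<Rightarrow> 'q list \<Rightarrow> nat \<Rightarrow> nat" where
  "padded \<nu> qs i = (map \<nu> qs @ [0, 0]) ! i"

fun sub_trans :: "nat \<Rightarrow> ('q \<Rightarrow> nat) \<Rightarrow> 'q list \<times> bag \<times> 'q \<Rightarrow> nat \<Rightarrow> nat list \<times> bag \<times> nat" where
  "sub_trans t \<nu> (qs, (B', b'), q) c = (let M = 2 ^ t; d = digit M c in
     (take (length qs) [code M (padded \<nu> qs 0) (d 7) (d 6) (d 5), code M (padded \<nu> qs 1) (d 4) (d 3) (d 2)],
      (set_of_mask t (d 1), set_of_mask t (d 0)),
      code M (\<nu> q) (mask B') (mask b') (d 1)))"

fun sub_admissible :: "nat \<Rightarrow> 'q list \<times> bag \<times> 'q \<Rightarrow> nat \<Rightarrow> bool" where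
  "sub_admissible t (qs, (B', b'), q) c = admissible t (length qs) (mask B') (mask b') c"

definition sub_trans_list ::
    "nat \<Rightarrow> ('q \<Rightarrow> nat) \<Rightarrow> ('q list \<times> bag \<times> 'q) list \<Rightarrow> (nat list \<times> bag \<times> nat) list" where
  "sub_trans_list t \<nu> ds =
     concat (map (\<lambda>d. map (sub_trans t \<nu> d) (filter (sub_admissible t d) [0..<(2 ^ t) ^ 8])) ds)"

fun num_of :: "('q \<Rightarrow> nat) \<Rightarrow> 'q list \<times> bag \<times> 'q \<Rightarrow> num_trans" where
  "num_of \<nu> (qs, (B, b), q) = (map \<nu> qs, mask B, mask b, \<nu> q)"

lemma trans_word_num_of: "trans_word \<nu> d = num_word (num_of \<nu> d)"
  by (cases "(\<nu>, d)" rule: trans_word.cases) simp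

text \<open>Ties the words written by the machine to transitions of the automaton. Arity at most 2
  ensures that \<open>take\<close> yields as many codes as the arity announces.\<close>

lemma trans_word_sub_trans:
  assumes "length (fst d) \<le> 2"
  shows "trans_word id (sub_trans t \<nu> d c) = (case d of (qs, (B', b'), q) \<Rightarrow>
    sub_word (2 ^ t) (length qs) (padded \<nu> qs 0) (padded \<nu> qs 1) (mask B') (mask b') (\<nu> q) c)"
proof -
  obtain qs B' b' q where d: "d = (qs, (B', b'), q)" by (metis prod.exhaust)
  show ?thesis
    using assms by (simp add: d Let_def sub_word_def mask_set_of_mask digit_less)
qed

lemma num_sub_num_of:
  assumes "length (fst d) \<le> 2"
  shows "num_sub t (num_of \<nu> d) =
    map (trans_word id) (map (sub_trans t \<nu> d) (filter (sub_admissible t d) [0..<(2 ^ t) ^ 8]))"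
proof -
  obtain qs B' b' q where d: "d = (qs, (B', b'), q)" by (metis prod.exhaust)
  have concat_if: "concat (map (\<lambda>c. if P c then [f c] else []) xs) = map f (filter P xs)"
    for P and f :: "nat \<Rightarrow> nat list" and xs
    by (induction xs) simp_all
  have "num_sub t (num_of \<nu> d) = concat (map (\<lambda>c. if sub_admissible t d c
      then [trans_word id (sub_trans t \<nu> d c)] else []) [0..<(2 ^ t) ^ 8])"
    unfolding trans_word_sub_trans[OF assms]
    by (simp add: d sub_words_def emitted_def[abs_def] padded_def cong: if_cong)
  then show ?thesis
    unfolding concat_if by (simp add: comp_def)
qed

text \<open>All digits can be recovered: \<open>B\<close> and \<open>b\<close> from the symbol,
  those of present children from their codes, and those of absent children are 0 by
  admissibility.\<close>

lemma sub_trans_inject_index: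
  assumes "sub_trans t \<nu> d c = sub_trans t \<nu> d c'" "sub_admissible t d c" "sub_admissible t d c'"
    "c < (2 ^ t) ^ 8" "c' < (2 ^ t) ^ 8" "length (fst d) \<le> 2"
  shows "c = c'"
proof -
  obtain qs B' b' q where d: "d = (qs, (B', b'), q)" by (metis prod.exhaust)
  let ?M = "(2 :: nat) ^ t"
  have less: "digit ?M e i < ?M" for e i by (simp add: digit_less)
  have mask_eq: "set_of_mask t (digit ?M c i) = set_of_mask t (digit ?M c' j) \<longleftrightarrow> digit ?M c i = digit ?M c' j" for i j
    by (metis mask_set_of_mask less)
  have "length qs \<le> 2" using assms(6) d by simp
  then have "length qs = 0 \<or> length qs = 1 \<or> length qs = 2" by linarith
  then have "digit ?M c i = digit ?M c' i" if "i \<in> {0, 1, 2, 3, 4, 5, 6, 7}" for i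
    using assms(1-3) that unfolding d
    by (elim disjE) (auto simp: Let_def admissible_def mask_eq code_inject[OF less less less less less less])
  then have "digit ?M c i = digit ?M c' i" if "i < 8" for i
    using that by (simp add: numeral_eq_Suc less_Suc_eq)
  then show ?thesis
    by (rule digit_eqI[OF assms(4,5)])
qed

lemma ball_atLeastAtMost_Suc: "(\<forall>s \<in> {1..t}. P s) \<longleftrightarrow> (\<forall>k < t. P (Suc k))"
proof
  assume R: "\<forall>k < t. P (Suc k)"
  show "\<forall>s \<in> {1..t}. P s"
  proof
    fix s assume "s \<in> {1..t}"
    then show "P s" using R by (cases s) auto
  qed
qed simp

text \<open>Here \<open>W i\<close> is the set coded by digit \<open>i\<close>. The
  \<open>{}\<close> in the child bags are placeholders, as \<open>consistent\<close> looks at vertex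
  sets only.\<close>

definition compatible_sets :: "nat \<Rightarrow> bag \<Rightarrow> bag \<Rightarrow> (nat \<Rightarrow> nat set) \<Rightarrow> bool" where
  "compatible_sets t a a' W \<longleftrightarrow> fst a \<subseteq> fst a' \<and> snd a \<subseteq> fst a \<and>
     consistent t a a' (W 5, {}) (W 7, W 6) \<and> consistent t a a' (W 2, {}) (W 4, W 3)"

lemma compatible_bits_iff:
  assumes W: "\<And>i. W i \<subseteq> {1..t}" and B': "fst a' \<subseteq> {1..t}"
  shows "(\<forall>k < t. compatible_bit (mask (fst a')) (mask (W 1)) (mask (W 0)) (mask (W 7)) (mask (W 5))
      (mask (W 4)) (mask (W 2)) k) \<longleftrightarrow> compatible_sets t (W 1, W 0) a' W"
proof -
  have "(\<forall>k < t. compatible_bit (mask (fst a')) (mask (W 1)) (mask (W 0)) (mask (W 7)) (mask (W 5))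
      (mask (W 4)) (mask (W 2)) k) \<longleftrightarrow>
    (\<forall>s \<in> {1..t}. (s \<in> W 1 \<longrightarrow> s \<in> fst a') \<and> (s \<in> W 0 \<longrightarrow> s \<in> W 1) \<and>
     (s \<in> fst a' \<longrightarrow> s \<in> W 7 \<longrightarrow> (s \<in> W 1 \<longleftrightarrow> s \<in> W 5)) \<and>
     (s \<in> fst a' \<longrightarrow> s \<in> W 4 \<longrightarrow> (s \<in> W 1 \<longleftrightarrow> s \<in> W 2)))"
    unfolding ball_atLeastAtMost_Suc compatible_bit_def bit_mask[OF W] bit_mask[OF B'] ..
  also have "\<dots> \<longleftrightarrow> compatible_sets t (W 1, W 0) a' W"
    unfolding compatible_sets_def consistent_def fst_conv snd_conv ball_conj_distrib
    using W[of 0] W[of 1] by blast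
  finally show ?thesis .
qed

lemma mask_eq_0_iff: "B \<subseteq> {1..t} \<Longrightarrow> mask B = 0 \<longleftrightarrow> B = {}"
  using mask_inject[of B t "{}"] by simp

lemma admissible_iff:
  assumes W: "\<And>i. W i \<subseteq> {1..t}" "\<And>i. i < 8 \<Longrightarrow> digit (2 ^ t) c i = mask (W i)"
    and a': "a' \<in> concrete_bags t"
  shows "admissible t r (mask (fst a')) (mask (snd a')) c \<longleftrightarrow>
    compatible_sets t (W 1, W 0) a' W \<and> (W 0 = {} \<or> W 0 = snd a') \<and>
    (r = 0 \<longrightarrow> W 7 = {} \<and> W 6 = {} \<and> W 5 = {}) \<and> (r \<le> 1 \<longrightarrow> W 4 = {} \<and> W 3 = {} \<and> W 2 = {})"
proof -
  have a'': "fst a' \<subseteq> {1..t}" "snd a' \<subseteq> {1..t}" using a' by (auto simp: concrete_bags_def)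
  have dig: "digit (2 ^ t) c 0 = mask (W 0)" "digit (2 ^ t) c 1 = mask (W 1)" "digit (2 ^ t) c 2 = mask (W 2)"
    "digit (2 ^ t) c 3 = mask (W 3)" "digit (2 ^ t) c 4 = mask (W 4)" "digit (2 ^ t) c 5 = mask (W 5)"
    "digit (2 ^ t) c 6 = mask (W 6)" "digit (2 ^ t) c 7 = mask (W 7)"
    by (rule W(2), simp)+
  show ?thesis
    unfolding admissible_def Let_def dig compatible_bits_iff[of W t a', OF W(1) a''(1)] mask_eq_0_iff[OF W(1)]
      mask_inject[OF W(1) a''(2)] ..
qed

text \<open>A sub-bag with a pair has the same pair, as the pairs have two elements.\<close>

lemma sub_bag_iff:
  assumes "a' \<in> concrete_bags t"
  shows "a \<in> concrete_bags t \<and> sub_bag a a' \<longleftrightarrow>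
    fst a \<subseteq> fst a' \<and> snd a \<subseteq> fst a \<and> (snd a = {} \<or> snd a = snd a')"
proof
  assume *: "a \<in> concrete_bags t \<and> sub_bag a a'"
  have "snd a' \<subseteq> {1..t}"
    using assms by (auto simp: concrete_bags_def)
  then have "finite (snd a')"
    by (rule finite_subset) simp
  then have "snd a = {} \<or> snd a = snd a'"
    using * assms by (auto simp: concrete_bags_def sub_bag_def dest: card_subset_eq)
  then show "fst a \<subseteq> fst a' \<and> snd a \<subseteq> fst a \<and> (snd a = {} \<or> snd a = snd a')"
    using * by (auto simp: concrete_bags_def sub_bag_def)
next
  assume *: "fst a \<subseteq> fst a' \<and> snd a \<subseteq> fst a \<and> (snd a = {} \<or> snd a = snd a')"
  moreover have "fst a' \<subseteq> {1..t}" "snd a' = {} \<or> card (snd a') = 2"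
    using assms by (auto simp: concrete_bags_def)
  ultimately have "fst a \<subseteq> {1..t}" "snd a = {} \<or> card (snd a) = 2" by (blast, metis)
  then show "a \<in> concrete_bags t \<and> sub_bag a a'"
    using * unfolding concrete_bags_def sub_bag_def case_prod_beta mem_Collect_eq by blast
qed

lemma length_le_2_cases:
  assumes "length xs \<le> 2"
  shows "xs = [] \<or> (\<exists>x. xs = [x]) \<or> (\<exists>x y. xs = [x, y])"
  using assms by (auto simp: le_Suc_eq length_Suc_conv numeral_2_eq_2)

section \<open>The sub-automaton and its transitions\<close>

locale bag_automaton =
  fixes t :: nat and A :: "('q, bag) ta" and \<nu> :: "'q \<Rightarrow> nat"
  assumes automaton: "tree_automaton (concrete_bags t) A"
    and inj: "inj_on \<nu> (states A)"
begin

text \<open>Of \<open>a\<close> only the vertex set enters: (S3) compares vertex sets, and the pair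
  of \<open>a\<close> is checked where it is read.\<close>

definition state :: "'q \<Rightarrow> bag \<Rightarrow> bag \<Rightarrow> nat" where
  "state q a' a = code (2 ^ t) (\<nu> q) (mask (fst a')) (mask (snd a')) (mask (fst a))"

definition sub_automaton :: "(nat, bag) ta" where
  "sub_automaton = \<lparr>states = {p. p div (2 ^ t) ^ 3 \<in> \<nu> ` states A}, final = {p. p div (2 ^ t) ^ 3 \<in> \<nu> ` final A},
     trans = {sub_trans t \<nu> d c |d c. d \<in> trans A \<and> c < (2 ^ t) ^ 8 \<and> sub_admissible t d c}\<rparr>"

text \<open>
  The pairs are the root bags of the children in \<open>T\<close> and in \<open>T'\<close>.  They need not be concrete bags,
  since transitions from unreachable states are generated as well.
\<close>

definition children :: "bag \<Rightarrow> bag \<Rightarrow> (bag \<times> bag) list \<Rightarrow> bool" where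
  "children a a' cs \<longleftrightarrow> (\<forall>(c, c') \<in> set cs. fst c \<subseteq> {1..t} \<and> fst c' \<subseteq> {1..t} \<and> snd c' \<subseteq> {1..t} \<and>
     consistent t a a' c c')"

lemma children_take: "children a a' cs \<Longrightarrow> children a a' (take n cs)"
  unfolding children_def by (meson in_set_takeD)

lemma trans_D:
  assumes "(qs, a, q) \<in> trans A"
  shows "length qs \<le> 2" "set qs \<subseteq> states A" "a \<in> concrete_bags t" "q \<in> states A"
  using assms automaton unfolding tree_automaton_def by auto

text \<open>Replaces the index \<open>c\<close> by the choice it encodes: a sub-bag at the node and
  consistent bags at the children. One direction decodes digits into sets, the other obtains
  \<open>c\<close> from \<open>ex_digits\<close>.\<close>

lemma sub_automaton_trans_iff:
  "(ps, a, p) \<in> trans sub_automaton \<longleftrightarrow> (\<exists>qs a' q cs. (qs, a', q) \<in> trans A \<and> a \<in> concrete_bags t \<and>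
     sub_bag a a' \<and> p = state q a' a \<and> length cs = length qs \<and>
     ps = map2 (\<lambda>q (c, c'). state q c' c) qs cs \<and> children a a' cs)" (is "?L \<longleftrightarrow> ?R")
proof
  assume ?L
  then obtain qs B' b' q c where d: "(qs, (B', b'), q) \<in> trans A" "c < (2 ^ t) ^ 8"
    "admissible t (length qs) (mask B') (mask b') c" "(ps, a, p) = sub_trans t \<nu> (qs, (B', b'), q) c"
    unfolding sub_automaton_def by auto
  define W where "W i = set_of_mask t (digit (2 ^ t) c i)" for i
  have W: "W i \<subseteq> {1..t}" and dig: "digit (2 ^ t) c i = mask (W i)" for i
    unfolding W_def by (rule set_of_mask_subset) (simp add: mask_set_of_mask digit_less)
  note D = trans_D[OF d(1)]
  have adm: "compatible_sets t (W 1, W 0) (B', b') W" "W 0 = {} \<or> W 0 = b'"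
    using d(3) admissible_iff[OF W dig D(3)] by simp_all
  have a: "a = (W 1, W 0)" and p: "p = state q (B', b') a"
    using d(4) by (simp_all add: Let_def W_def state_def mask_set_of_mask digit_less)
  \<comment> \<open>\<open>W 7\<close>, \<open>W 6\<close>, \<open>W 5\<close> are
    \<open>B'\<close>, \<open>b'\<close>, \<open>B\<close> of the first child, and
    \<open>W 4\<close>, \<open>W 3\<close>, \<open>W 2\<close> those of the second. States do not
    record the pair of a child in \<open>T\<close>, so \<open>{}\<close> stands in for it.\<close>
  define cs where "cs = take (length qs) [((W 5, {} :: nat set), (W 7, W 6)), ((W 2, {}), (W 4, W 3))]"
  have "length cs = length qs \<and> ps = map2 (\<lambda>q (c, c'). state q c' c) qs cs"
    using length_le_2_cases[OF D(1)] d(4) by (auto simp: cs_def Let_def state_def padded_def dig)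
  moreover have "children a (B', b') cs"
    unfolding cs_def using adm(1) W
    by (intro children_take) (simp add: children_def compatible_sets_def a)
  moreover have "a \<in> concrete_bags t \<and> sub_bag a (B', b')"
    unfolding sub_bag_iff[OF D(3)] using adm by (simp add: a compatible_sets_def)
  ultimately show ?R
    using d(1) p by blast
next
  assume ?R
  then obtain qs a' q cs where d: "(qs, a', q) \<in> trans A" and a: "a \<in> concrete_bags t \<and> sub_bag a a'"
    and p: "p = state q a' a" and cs: "length cs = length qs" "children a a' cs"
    and ps: "ps = map2 (\<lambda>q (c, c'). state q c' c) qs cs" by blast
  note D = trans_D[OF d]
  \<comment> \<open>Padding with empty bags gives two children in every case; empty bags are
    consistent with anything and produce the zero digits demanded of absent children.\<close>
  define cs' where "cs' = cs @ [(({}, {}), ({}, {})), (({}, {}), ({}, {}))]"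
  \<comment> \<open>The list follows the digits 0 to 7; beyond them \<open>{}\<close> keeps
    \<open>W i \<subseteq> {1..t}\<close> true for every \<open>i\<close>.\<close>
  define W where "W i = (if i < 8 then [snd a, fst a, fst (fst (cs' ! 1)), snd (snd (cs' ! 1)), fst (snd (cs' ! 1)),
    fst (fst (cs' ! 0)), snd (snd (cs' ! 0)), fst (snd (cs' ! 0))] ! i else {})" for i
  have "children a a' cs'"
    using cs(2) by (auto simp: children_def cs'_def consistent_def)
  moreover have "cs' ! 0 \<in> set cs'" "cs' ! 1 \<in> set cs'"
    unfolding cs'_def by (rule nth_mem, simp)+
  ultimately have child: "fst (fst (cs' ! i)) \<subseteq> {1..t} \<and> fst (snd (cs' ! i)) \<subseteq> {1..t} \<and> snd (snd (cs' ! i)) \<subseteq> {1..t} \<and>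
     consistent t a a' (fst (cs' ! i)) (snd (cs' ! i))" if "i \<in> {0, 1}" for i
    using that unfolding children_def by (auto simp: case_prod_beta)
  have a_subset: "fst a \<subseteq> {1..t}" "snd a \<subseteq> {1..t}"
    using a by (auto simp: concrete_bags_def)
  have W_nth: "W 0 = snd a" "W 1 = fst a" "W 2 = fst (fst (cs' ! 1))" "W 3 = snd (snd (cs' ! 1))"
    "W 4 = fst (snd (cs' ! 1))" "W 5 = fst (fst (cs' ! 0))" "W 6 = snd (snd (cs' ! 0))" "W 7 = fst (snd (cs' ! 0))"
    by (simp_all add: W_def)
  have W: "W i \<subseteq> {1..t}" for i
  proof (cases "i < 8")
    case True
    then have "i \<in> {0, 1, 2, 3, 4, 5, 6, 7}" by (simp add: numeral_eq_Suc less_Suc_eq) 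
    then show ?thesis
      using child[of 0] child[of 1] a_subset by (elim insertE) (simp_all only: W_nth, auto)
  qed (simp add: W_def)
  obtain c where c: "c < (2 ^ t) ^ 8" and dig: "\<And>i. i < 8 \<Longrightarrow> digit (2 ^ t) c i = mask (W i)"
    using ex_digits[of 8 "\<lambda>i. mask (W i)" "2 ^ t"] mask_less[OF W] by blast
  have "compatible_sets t a a' W" 
    unfolding compatible_sets_def W_nth using child[of 0] child[of 1] a sub_bag_iff[OF D(3), of a]
    by (simp add: consistent_def)
  moreover have "(W 1, W 0) = a" by (simp only: W_nth prod.collapse)
  moreover have "W 0 = {} \<or> W 0 = snd a'"
    using sub_bag_iff[OF D(3), of a] a by (simp add: W_nth)
  moreover have "W 7 = {} \<and> W 6 = {} \<and> W 5 = {}" if "length qs = 0"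
    using that cs(1) by (simp add: W_nth cs'_def)
  moreover have "W 4 = {} \<and> W 3 = {} \<and> W 2 = {}" if "length qs \<le> 1"
  proof -
    have "cs = [] \<or> (\<exists>x. cs = [x])"
      using that cs(1) by (auto simp: le_Suc_eq length_Suc_conv)
    then show ?thesis unfolding W_nth cs'_def by auto
  qed
  ultimately have "admissible t (length qs) (mask (fst a')) (mask (snd a')) c"
    by (intro iffD2[OF admissible_iff[of W t c a', OF W dig D(3)]]) simp_all
  then have "sub_admissible t (qs, a', q) c"
    by (cases a') simp
  moreover have "sub_trans t \<nu> (qs, a', q) c = (ps, a, p)"
  proof -
    have "set_of_mask t (mask (fst a)) = fst a" "set_of_mask t (mask (snd a)) = snd a"
      using a_subset by (simp_all only: set_of_mask_mask)
    moreover have "ps = take (length qs) [code (2 ^ t) (padded \<nu> qs 0) (mask (W 7)) (mask (W 6)) (mask (W 5)),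
        code (2 ^ t) (padded \<nu> qs 1) (mask (W 4)) (mask (W 3)) (mask (W 2))]"
      using length_le_2_cases[OF D(1)] cs(1)
      by (auto simp: ps padded_def state_def W_nth cs'_def length_Suc_conv split: prod.splits)
    ultimately show ?thesis
      by (cases a') (simp add: Let_def dig p state_def W_nth W_nth(2)[unfolded One_nat_def])
  qed
  ultimately show ?L
    unfolding sub_automaton_def ta.select_convs mem_Collect_eq using d c by metis
qed

end

section \<open>Runs and the language of the sub-automaton\<close>

context bag_automaton
begin

lemma sub_automaton_transE:
  assumes "(ps, a, p) \<in> trans sub_automaton"
  obtains qs a' q cs where "(qs, a', q) \<in> trans A" "a \<in> concrete_bags t" "sub_bag a a'"
    "p = state q a' a" "length cs = length qs" "ps = map2 (\<lambda>q (c, c'). state q c' c) qs cs"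
    "children a a' cs"
  using assms unfolding sub_automaton_trans_iff by (elim exE conjE) (rule that)

lemma state_div:
  assumes "fst c \<subseteq> {1..t}" "fst c' \<subseteq> {1..t}" "snd c' \<subseteq> {1..t}"
  shows "state q c' c div (2 ^ t) ^ 3 = \<nu> q"
  unfolding state_def using assms by (intro code_div mask_less)

text \<open>Identifies the bags guessed by a transition with the root bags of the terms below it.
  The bounds make all masks genuine base-\<open>M\<close> digits.\<close>

lemma state_inject:
  assumes "q \<in> states A" "fst c \<subseteq> {1..t}" "fst c' \<subseteq> {1..t}" "snd c' \<subseteq> {1..t}"
    and "p \<in> states A" "fst e \<subseteq> {1..t}" "fst e' \<subseteq> {1..t}" "snd e' \<subseteq> {1..t}"
    and eq: "state q c' c = state p e' e"
  shows "q = p" "c' = e'" "fst c = fst e"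
proof -
  have "\<nu> q = \<nu> p \<and> mask (fst c') = mask (fst e') \<and> mask (snd c') = mask (snd e') \<and> mask (fst c) = mask (fst e)"
    using eq unfolding state_def using assms by (subst (asm) code_inject) (simp_all only: mask_less)
  then have "\<nu> q = \<nu> p" "fst c' = fst e'" "snd c' = snd e'" "fst c = fst e"
    using assms mask_inject by metis+
  then show "q = p" "c' = e'" "fst c = fst e"
    using inj assms(1,5) by (auto simp: prod_eq_iff dest: inj_onD)
qed

lemma concrete_bags_D:
  "a \<in> concrete_bags t \<Longrightarrow> fst a \<subseteq> {1..t}" "a \<in> concrete_bags t \<Longrightarrow> snd a \<subseteq> {1..t}"
  by (auto simp: concrete_bags_def)

lemma reaches_D:
  assumes "reaches A T q"
  shows "q \<in> states A" "root T \<in> concrete_bags t"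
proof -
  have "q \<in> states A \<and> root T \<in> concrete_bags t"
    using assms by cases (simp_all add: trans_D)
  then show "q \<in> states A" "root T \<in> concrete_bags t" by simp_all
qed

lemma root_Ter: "T \<in> Ter \<Sigma> \<Longrightarrow> root T \<in> \<Sigma>"
  by (erule Ter.cases) simp_all

lemma Ter_simps:
  "Nullary a \<in> Ter \<Sigma> \<longleftrightarrow> a \<in> \<Sigma>"
  "Unary a u \<in> Ter \<Sigma> \<longleftrightarrow> a \<in> \<Sigma> \<and> u \<in> Ter \<Sigma>"
  "Binary a u v \<in> Ter \<Sigma> \<longleftrightarrow> a \<in> \<Sigma> \<and> u \<in> Ter \<Sigma> \<and> v \<in> Ter \<Sigma>"
  by (subst Ter.simps, simp)+

lemma consistent_cong: "fst c = fst e \<Longrightarrow> consistent t a a' c c' \<longleftrightarrow> consistent t a a' e c'"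
  by (simp add: consistent_def)

text \<open>The induction assembles \<open>T'\<close> bottom-up from the transitions of
  \<open>A\<close> behind those of the run.\<close>

lemma reaches_sub_automaton_D:
  "reaches sub_automaton T p \<Longrightarrow>
     \<exists>q T'. reaches A T' q \<and> T \<in> Ter (concrete_bags t) \<and> sub_term t T T' \<and> p = state q (root T') (root T)"
proof (induction rule: reaches.induct)
  case (1 a p)
  obtain qs a' q cs where *: "(qs, a', q) \<in> trans A" "a \<in> concrete_bags t" "sub_bag a a'"
    "p = state q a' a" "length cs = length qs" "[] = map2 (\<lambda>q (c, c'). state q c' c) qs cs"
    using 1 by (rule sub_automaton_transE)
  then have "qs = []" by auto
  then show ?case
    using * by (intro exI[of _ q] exI[of _ "Nullary a'"]) (auto intro: reaches.intros Ter.intros)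
next
  case (2 p1 a p u)
  obtain qs a' q cs where *: "(qs, a', q) \<in> trans A" "a \<in> concrete_bags t" "sub_bag a a'"
    "p = state q a' a" "length cs = length qs" "[p1] = map2 (\<lambda>q (c, c'). state q c' c) qs cs"
    "children a a' cs"
    using 2(1) by (rule sub_automaton_transE)
  obtain q1 c c' where cs: "qs = [q1]" "cs = [(c, c')]" "p1 = state q1 c' c"
    using *(5,6) by (cases qs; cases cs) auto
  obtain q1' u' where u': "reaches A u' q1'" "u \<in> Ter (concrete_bags t)" "sub_term t u u'"
    "p1 = state q1' (root u') (root u)"
    using 2 by blast
  \<comment> \<open>The state \<open>p1\<close> arises both from the guess of the transition and
    from the term \<open>u'\<close> of the induction hypothesis, so the two agree.\<close>
  have "q1 = q1'" "c' = root u'" "fst c = fst (root u)"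
    by (rule state_inject[of q1 c c' q1' "root u" "root u'"];
      use trans_D[OF *(1)] *(7) cs u' reaches_D[OF u'(1)] root_Ter[OF u'(2)] concrete_bags_D in
      \<open>auto simp: children_def\<close>)+
  then show ?case
    using * cs u' consistent_cong[of c "root u" a a' c']
    by (intro exI[of _ q] exI[of _ "Unary a' u'"]) (auto simp: children_def intro: reaches.intros Ter.intros)
next
  case (3 p1 p2 a p u v)
  obtain qs a' q cs where *: "(qs, a', q) \<in> trans A" "a \<in> concrete_bags t" "sub_bag a a'"
    "p = state q a' a" "length cs = length qs" "[p1, p2] = map2 (\<lambda>q (c, c'). state q c' c) qs cs"
    "children a a' cs"
    using 3(1) by (rule sub_automaton_transE)
  obtain q1 c c' q2 e e' where cs: "qs = [q1, q2]" "cs = [(c, c'), (e, e')]" "p1 = state q1 c' c" "p2 = state q2 e' e"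
    using *(5,6) by (cases qs; cases cs; cases "tl qs"; cases "tl cs") auto
  obtain q1' u' where u': "reaches A u' q1'" "u \<in> Ter (concrete_bags t)" "sub_term t u u'"
    "p1 = state q1' (root u') (root u)"
    using 3 by blast
  obtain q2' v' where v': "reaches A v' q2'" "v \<in> Ter (concrete_bags t)" "sub_term t v v'"
    "p2 = state q2' (root v') (root v)"
    using 3 by blast
  have "q1 = q1'" "c' = root u'" "fst c = fst (root u)"
    by (rule state_inject[of q1 c c' q1' "root u" "root u'"];
      use trans_D[OF *(1)] *(7) cs u' reaches_D[OF u'(1)] root_Ter[OF u'(2)] concrete_bags_D in
      \<open>auto simp: children_def\<close>)+
  moreover have "q2 = q2'" "e' = root v'" "fst e = fst (root v)"
    by (rule state_inject[of q2 e e' q2' "root v" "root v'"];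
      use trans_D[OF *(1)] *(7) cs v' reaches_D[OF v'(1)] root_Ter[OF v'(2)] concrete_bags_D in
      \<open>auto simp: children_def\<close>)+
  ultimately show ?case
    using * cs u' v' consistent_cong[of c "root u" a a' c'] consistent_cong[of e "root v" a a' e']
    by (intro exI[of _ q] exI[of _ "Binary a' u' v'"]) (auto simp: children_def intro: reaches.intros Ter.intros)
qed

text \<open>Here \<open>T'\<close> is given, so each node uses the transition that guesses the
  actual root bags of the arguments; \<open>sub_term\<close> forces \<open>T\<close> into the shape
  of \<open>T'\<close>.\<close>

lemma reaches_sub_automaton_I:
  "reaches A T' q \<Longrightarrow> T \<in> Ter (concrete_bags t) \<Longrightarrow> sub_term t T T' \<Longrightarrow>
     reaches sub_automaton T (state q (root T') (root T))"
proof (induction arbitrary: T rule: reaches.induct)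
  case (1 a' q)
  then obtain a where T: "T = Nullary a" "sub_bag a a'" "a \<in> concrete_bags t"
    by (cases T) (auto simp: Ter_simps)
  have "([], a, state q a' a) \<in> trans sub_automaton"
    unfolding sub_automaton_trans_iff using 1 T
    by (intro exI[of _ "[]"] exI[of _ a'] exI[of _ q]) (auto simp: children_def)
  then show ?case
    using T by (auto intro: reaches.intros)
next
  case (2 q1 a' q u')
  then obtain a u where T: "T = Unary a u" "sub_bag a a'" "a \<in> concrete_bags t" "u \<in> Ter (concrete_bags t)"
    "consistent t a a' (root u) (root u')" "sub_term t u u'"
    by (cases T) (auto simp: Ter_simps)
  have "([state q1 (root u') (root u)], a, state q a' a) \<in> trans sub_automaton"
    unfolding sub_automaton_trans_iff
    using 2 T reaches_D[of u' q1] root_Ter[OF T(4)] concrete_bags_D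
    by (intro exI[of _ "[q1]"] exI[of _ a'] exI[of _ q] exI[of _ "[(root u, root u')]"]) (auto simp: children_def)
  then show ?case
    using T 2 by (auto intro: reaches.intros)
next
  case (3 q1 q2 a' q u' v')
  then obtain a u v where T: "T = Binary a u v" "sub_bag a a'" "a \<in> concrete_bags t" "u \<in> Ter (concrete_bags t)"
    "v \<in> Ter (concrete_bags t)"
    "consistent t a a' (root u) (root u')" "consistent t a a' (root v) (root v')" "sub_term t u u'" "sub_term t v v'"
    by (cases T) (auto simp: Ter_simps)
  have "([state q1 (root u') (root u), state q2 (root v') (root v)], a, state q a' a) \<in> trans sub_automaton"
    unfolding sub_automaton_trans_iff
    using 3 T reaches_D[of u' q1] reaches_D[of v' q2] root_Ter[OF T(4)] root_Ter[OF T(5)] concrete_bags_D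
    by (intro exI[of _ "[q1, q2]"] exI[of _ a'] exI[of _ q] exI[of _ "[(root u, root u'), (root v, root v')]"])
      (auto simp: children_def)
  then show ?case
    using T 3 by (auto intro: reaches.intros)
qed

text \<open>The quotient by \<open>M ^ 3\<close> is \<open>\<nu> q\<close>, and injectivity of
  \<open>\<nu>\<close> keeps a nonfinal state from sharing a number with a final one.\<close>

lemma state_final:
  assumes "reaches A T' q" "root T \<in> concrete_bags t"
  shows "state q (root T') (root T) \<in> final sub_automaton \<longleftrightarrow> q \<in> final A"
proof -
  have "state q (root T') (root T) div (2 ^ t) ^ 3 = \<nu> q"
    using assms reaches_D(2)[OF assms(1)] by (intro state_div concrete_bags_D)
  moreover have "final A \<subseteq> states A" using automaton by (simp add: tree_automaton_def)
  ultimately show ?thesis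
    using inj reaches_D(1)[OF assms(1)] by (auto simp: sub_automaton_def dest: inj_onD)
qed

lemma lang_sub_automaton:
  "lang sub_automaton = {T \<in> Ter (concrete_bags t). \<exists>T' \<in> lang A. sub_decomposition t T T'}"
proof (intro set_eqI iffI)
  fix T
  assume "T \<in> lang sub_automaton"
  then obtain p where "p \<in> final sub_automaton" "reaches sub_automaton T p"
    by (auto simp: lang_def)
  then obtain q T' where *: "reaches A T' q" "T \<in> Ter (concrete_bags t)" "sub_term t T T'"
    "state q (root T') (root T) \<in> final sub_automaton"
    using reaches_sub_automaton_D by blast
  then have "q \<in> final A" using state_final root_Ter by blast
  then show "T \<in> {T \<in> Ter (concrete_bags t). \<exists>T' \<in> lang A. sub_decomposition t T T'}"
    using * by (auto simp: lang_def sub_decomposition_iff_sub_term)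
next
  fix T
  assume "T \<in> {T \<in> Ter (concrete_bags t). \<exists>T' \<in> lang A. sub_decomposition t T T'}"
  then obtain q T' where *: "q \<in> final A" "reaches A T' q" "T \<in> Ter (concrete_bags t)" "sub_term t T T'"
    by (auto simp: lang_def sub_decomposition_iff_sub_term)
  then show "T \<in> lang sub_automaton"
    using state_final[OF *(2) root_Ter[OF *(3)]] reaches_sub_automaton_I[OF *(2-4)]
    unfolding lang_def by blast
qed

text \<open>The target code reveals \<open>q\<close>, \<open>B'\<close> and \<open>b'\<close>, and
  the source codes reveal \<open>qs\<close>, their number being the arity.\<close>

lemma sub_trans_inject_trans:
  assumes "sub_trans t \<nu> d c = sub_trans t \<nu> d' c'" "d \<in> trans A" "d' \<in> trans A"
  shows "d = d'"
proof -
  obtain qs B b q where d: "d = (qs, (B, b), q)" by (metis prod.exhaust)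
  obtain qs' B' b' q' where d': "d' = (qs', (B', b'), q')" by (metis prod.exhaust)
  let ?M = "(2 :: nat) ^ t"
  have less: "digit ?M e i < ?M" for e i by (simp add: digit_less)
  note D = trans_D[OF assms(2)[unfolded d]] and D' = trans_D[OF assms(3)[unfolded d']]
  have sets: "B \<subseteq> {1..t}" "b \<subseteq> {1..t}" "B' \<subseteq> {1..t}" "b' \<subseteq> {1..t}"
    using concrete_bags_D[OF D(3)] concrete_bags_D[OF D'(3)] by simp_all
  have "code ?M (\<nu> q) (mask B) (mask b) (digit ?M c 1) = code ?M (\<nu> q') (mask B') (mask b') (digit ?M c' 1)"
    using assms(1) unfolding d d' by (simp add: Let_def)
  then have "\<nu> q = \<nu> q'" "mask B = mask B'" "mask b = mask b'"
    using code_inject[OF mask_less mask_less less mask_less mask_less less, OF sets] by simp_all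
  then have "q = q'" "B = B'" "b = b'"
    using inj_onD[OF inj, of q q'] D(4) D'(4) sets mask_inject[of _ t] by auto
  moreover have "qs = qs'"
  proof -
    have "take (length qs) [code ?M (padded \<nu> qs 0) (digit ?M c 7) (digit ?M c 6) (digit ?M c 5),
        code ?M (padded \<nu> qs 1) (digit ?M c 4) (digit ?M c 3) (digit ?M c 2)] =
      take (length qs') [code ?M (padded \<nu> qs' 0) (digit ?M c' 7) (digit ?M c' 6) (digit ?M c' 5),
        code ?M (padded \<nu> qs' 1) (digit ?M c' 4) (digit ?M c' 3) (digit ?M c' 2)]"
      using assms(1) unfolding d d' by (simp add: Let_def)
    then have "map \<nu> qs = map \<nu> qs'"
      using length_le_2_cases[OF D(1)] length_le_2_cases[OF D'(1)]
      by (auto simp: padded_def code_inject[OF less less less less less less])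
    then show ?thesis
      using inj D(2) D'(2) by (meson inj_on_map_eq_map inj_on_subset le_sup_iff)
  qed
  ultimately show ?thesis by (simp add: d d')
qed

end

section \<open>Output without repetition, and well-formedness of the automaton\<close>

lemma distinct_concat_map:
  assumes "distinct xs" "\<And>x. x \<in> set xs \<Longrightarrow> distinct (f x)"
    "\<And>x y. x \<in> set xs \<Longrightarrow> y \<in> set xs \<Longrightarrow> x \<noteq> y \<Longrightarrow> set (f x) \<inter> set (f y) = {}"
  shows "distinct (concat (map f xs))"
  using assms
proof (induction xs)
  case (Cons x xs)
  have "set (f x) \<inter> set (f y) = {}" if "y \<in> set xs" for y
    using Cons.prems(1) that by (intro Cons.prems(3)) auto
  moreover have "distinct (concat (map f xs))"
    using Cons.prems by (intro Cons.IH) auto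
  ultimately show ?case
    using Cons.prems(2)[of x] by auto
qed simp

context bag_automaton
begin

lemma set_sub_trans_list: "set ds = trans A \<Longrightarrow> set (sub_trans_list t \<nu> ds) = trans sub_automaton"
  by (simp add: sub_trans_list_def sub_automaton_def del: split_paired_Ex sub_trans.simps sub_admissible.simps) blast

lemma distinct_sub_trans_list:
  assumes "distinct ds" "set ds = trans A"
  shows "distinct (sub_trans_list t \<nu> ds)"
  unfolding sub_trans_list_def
proof (rule distinct_concat_map[OF assms(1)])
  fix d
  assume "d \<in> set ds"
  then have "length (fst d) \<le> 2"
    using assms(2) trans_D(1)[of "fst d" "fst (snd d)" "snd (snd d)"] by simp
  then show "distinct (map (sub_trans t \<nu> d) (filter (sub_admissible t d) [0..<(2 ^ t) ^ 8]))"
    unfolding distinct_map by (auto intro!: inj_onI dest: sub_trans_inject_index)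
next
  fix d d'
  assume "d \<in> set ds" "d' \<in> set ds" "d \<noteq> d'"
  then have "sub_trans t \<nu> d c \<noteq> sub_trans t \<nu> d' c'" for c c'
    using sub_trans_inject_trans[of d c d' c'] assms(2) by blast
  then show "set (map (sub_trans t \<nu> d) (filter (sub_admissible t d) [0..<(2 ^ t) ^ 8])) \<inter>
      set (map (sub_trans t \<nu> d') (filter (sub_admissible t d') [0..<(2 ^ t) ^ 8])) = {}"
    unfolding set_map by blast
qed

lemma tree_automaton_sub_automaton: "tree_automaton (concrete_bags t) sub_automaton"
proof -
  obtain qs ds where qs: "set qs = \<nu> ` states A" and ds: "set ds = trans A"
    using automaton unfolding tree_automaton_def by (meson finite_imageI finite_list)
  have "states sub_automaton = set (concat (map (state_codes t) qs))"
    unfolding set_concat_state_codes qs by (simp add: sub_automaton_def)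
  then have "finite (states sub_automaton)" by simp
  moreover have "finite (trans sub_automaton)"
    using set_sub_trans_list[OF ds] by (metis List.finite_set)
  moreover have "final sub_automaton \<subseteq> states sub_automaton"
    using automaton by (auto simp: sub_automaton_def tree_automaton_def)
  moreover have "length ps \<le> 2 \<and> set ps \<subseteq> states sub_automaton \<and> a \<in> concrete_bags t \<and> p \<in> states sub_automaton"
    if tr: "(ps, a, p) \<in> trans sub_automaton" for ps a p
  proof -
    obtain qs a' q cs where *: "(qs, a', q) \<in> trans A" "a \<in> concrete_bags t" "sub_bag a a'"
      "p = state q a' a" "length cs = length qs" "ps = map2 (\<lambda>q (c, c'). state q c' c) qs cs" "children a a' cs"
      using tr by (rule sub_automaton_transE)
    note D = trans_D[OF *(1)]
    have "p div (2 ^ t) ^ 3 = \<nu> q"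
      unfolding *(4) using *(2) D(3) by (intro state_div concrete_bags_D)
    moreover have "r div (2 ^ t) ^ 3 \<in> \<nu> ` states A" if r: "r \<in> set ps" for r
    proof -
      obtain q1 c c' where q1: "(q1, (c, c')) \<in> set (zip qs cs)" and "r = state q1 c' c"
        using r unfolding *(6) by auto
      moreover have "q1 \<in> set qs" "(c, c') \<in> set cs"
        using q1 by (auto dest: set_zip_leftD set_zip_rightD)
      moreover have "fst c \<subseteq> {1..t} \<and> fst c' \<subseteq> {1..t} \<and> snd c' \<subseteq> {1..t}"
        using *(7) \<open>(c, c') \<in> set cs\<close> unfolding children_def by blast
      ultimately have "r div (2 ^ t) ^ 3 = \<nu> q1"
        by (simp only: state_div)
      then show ?thesis using D(2) \<open>q1 \<in> set qs\<close> by auto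
    qed
    moreover have "length ps = length qs"
      using *(5,6) by simp
    ultimately show ?thesis
      using D(1,4) *(2) by (auto simp: sub_automaton_def)
  qed
  ultimately show ?thesis
    unfolding tree_automaton_def by blast
qed

lemma represents_sub_automaton:
  assumes "distinct qs" "set qs = states A" "distinct fs" "set fs = final A" "distinct ds" "set ds = trans A"
  shows "represents t (num_output t (map \<nu> qs) (map \<nu> fs) (map (num_of \<nu>) ds)) sub_automaton"
proof -
  let ?Q = "concat (map (state_codes t) (map \<nu> qs))" and ?F = "concat (map (state_codes t) (map \<nu> fs))"
  let ?D = "sub_trans_list t \<nu> ds"
  have "final A \<subseteq> states A" using automaton by (simp add: tree_automaton_def)
  then have "distinct (map \<nu> qs)" "distinct (map \<nu> fs)"
    using assms(1-4) inj by (auto simp: distinct_map intro: inj_on_subset)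
  then have "distinct ?Q" "distinct ?F" by (simp_all only: distinct_state_codes)
  moreover have "set ?Q = states sub_automaton" "set ?F = final sub_automaton"
    unfolding set_concat_state_codes using assms(2,4) by (simp_all add: sub_automaton_def)
  moreover have "concat (map (num_sub t) (map (num_of \<nu>) ds)) = map (trans_word id) ?D"
  proof -
    have "num_sub t (num_of \<nu> d) =
        map (trans_word id) (map (sub_trans t \<nu> d) (filter (sub_admissible t d) [0..<(2 ^ t) ^ 8]))"
      if "d \<in> set ds" for d
      using that assms(6) trans_D(1)[of "fst d" "fst (snd d)" "snd (snd d)"]
      by (intro num_sub_num_of) simp
    then show ?thesis
      unfolding sub_trans_list_def map_concat map_map by (intro arg_cong[of _ _ concat]) simp
  qed
  \<comment> \<open>States of the new automaton are numbers already, so \<open>id\<close> names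
    them.\<close>
  ultimately show ?thesis
    unfolding represents_def num_output_def Let_def
    using distinct_sub_trans_list[OF assms(5,6)] set_sub_trans_list[OF assms(6)]
    by (intro exI[of _ id] exI[of _ ?Q] exI[of _ ?F] exI[of _ ?D]) simp
qed

end

section \<open>Absorbing the polynomial factors into a power of two\<close>

lemma running_time_bound:
  fixes t :: nat
  assumes "n \<le> 24 * t + 46 + (9 * t + 6 * (2 ^ t) ^ 3 + 12) * (nq + nf) + ((186 * t + 115) * (2 ^ t) ^ 8 + 26) * nd"
    and "nf \<le> nq"
  shows "n \<le> 2 ^ (9 * t + 9) * max 1 (nq + nd)"
proof -
  define M :: nat where "M = 2 ^ t"
  have "M \<ge> 1" by (simp add: M_def)
  have "t < M" unfolding M_def by (rule less_exp)
  have pow: "M ^ i \<le> M ^ 9" if "i \<le> 9" for i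
    using that \<open>M \<ge> 1\<close> by (rule power_increasing)
  have 9: "1 \<le> M ^ 9" "t \<le> M ^ 9" "M ^ 3 \<le> M ^ 9" "M ^ 8 \<le> M ^ 9"
    using pow[of 0] pow[of 1] \<open>t < M\<close> pow[of 3] pow[of 8] by simp_all
  \<comment> \<open>The factor \<open>t\<close> in front of \<open>M ^ 8\<close> costs one more
    power of \<open>M\<close>, which makes 9 the exponent.\<close>
  have "t * M ^ 8 \<le> M * M ^ 8" using \<open>t < M\<close> by simp
  also have "\<dots> = M ^ 9" by (simp flip: power_Suc)
  finally have 8: "t * M ^ 8 \<le> M ^ 9" .
  let ?m = "max 1 (nq + nd)"
  \<comment> \<open>The fixed cost arises even for an automaton of size 0, which is why the bound
    contains \<open>max 1\<close>.\<close>
  have "24 * t + 46 \<le> 70 * M ^ 9" using 9 by linarith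
  also have "\<dots> \<le> 70 * M ^ 9 * ?m" by simp
  finally have a: "24 * t + 46 \<le> 70 * M ^ 9 * ?m" .
  have "9 * t + 6 * M ^ 3 + 12 \<le> 27 * M ^ 9" using 9 by linarith
  then have b: "(9 * t + 6 * M ^ 3 + 12) * (nq + nf) \<le> 27 * M ^ 9 * (2 * nq)"
    using assms(2) by (intro mult_le_mono) auto
  have "(186 * t + 115) * M ^ 8 + 26 \<le> 327 * M ^ 9"
    using 9 8 by (simp add: algebra_simps)
  then have c: "((186 * t + 115) * M ^ 8 + 26) * nd \<le> 327 * M ^ 9 * nd"
    by (rule mult_le_mono1)
  have "27 * M ^ 9 * (2 * nq) + 327 * M ^ 9 * nd \<le> 327 * M ^ 9 * (nq + nd)"
    by (simp add: algebra_simps)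
  also have "\<dots> \<le> 327 * M ^ 9 * ?m" by simp
  finally have "n \<le> 70 * M ^ 9 * ?m + 327 * M ^ 9 * ?m"
    using assms(1) a b c unfolding M_def by linarith
  \<comment> \<open>This uses \<open>70 + 327 \<le> 512\<close>.\<close>
  also have "\<dots> \<le> 2 ^ 9 * M ^ 9 * ?m" by simp
  also have "2 ^ 9 * M ^ 9 = 2 ^ (9 * t + 9)"
    by (simp add: M_def power_add power_mult mult.commute)
  finally show ?thesis .
qed

theorem theorem4p3:
  "\<exists>(P :: ram) (f :: nat \<Rightarrow> nat).
     (\<lambda>t. real (f t)) \<in> O(\<lambda>t. real t) \<and>
     (\<forall>(t :: nat) (A :: ('q, bag) ta) (xs :: nat list).
        tree_automaton (concrete_bags t) A \<longrightarrow> represents t xs A \<longrightarrow>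
        (\<exists>(n :: nat) (ys :: nat list) (SubA :: (nat, bag) ta).
           computes_in P xs n ys \<and>
           n \<le> 2 ^ f t * max 1 (ta_size A) \<and>
           represents t ys SubA \<and>
           tree_automaton (concrete_bags t) SubA \<and>
           lang SubA = {T \<in> Ter (concrete_bags t). \<exists>T' \<in> lang A. sub_decomposition t T T'}))"
proof (intro exI[of _ Sub_Program] exI[of _ "\<lambda>t. 9 * t + 9"] conjI allI impI)
  \<comment> \<open>The constant 18 works from \<open>t = 1\<close> on, where
    \<open>9 \<le> 9 * t\<close>.\<close>
  show "(\<lambda>t. real (9 * t + 9)) \<in> O(\<lambda>t. real t)"
    by (rule bigoI[of _ 18]) (auto simp: eventually_at_top_linorder intro!: exI[of _ 1])
next
  fix t :: nat and A :: "('q, bag) ta" and xs :: "nat list"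
  assume A: "tree_automaton (concrete_bags t) A" and "represents t xs A"
  then obtain \<nu> qs fs ds where \<nu>: "inj_on \<nu> (states A)"
    and qs: "distinct qs" "set qs = states A" and fs: "distinct fs" "set fs = final A"
    and ds: "distinct ds" "set ds = trans A"
    and xs: "xs = [t] @ (length qs # map \<nu> qs) @ (length fs # map \<nu> fs)
             @ (length ds # concat (map (trans_word \<nu>) ds))"
    unfolding represents_def by blast
  interpret bag_automaton t A \<nu>
    using A \<nu> by unfold_locales
  let ?ys = "num_output t (map \<nu> qs) (map \<nu> fs) (map (num_of \<nu>) ds)"
  have "xs = [t] @ (length (map \<nu> qs) # map \<nu> qs) @ (length (map \<nu> fs) # map \<nu> fs)
      @ (length (map (num_of \<nu>) ds) # concat (map num_word (map (num_of \<nu>) ds)))"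
    unfolding xs by (simp add: trans_word_num_of[abs_def] comp_def)
  moreover have "length ps \<le> 2 \<and> x < 2 ^ t" if mem: "(ps, x, y, q) \<in> set (map (num_of \<nu>) ds)" for ps x y q
  proof -
    obtain d where "d \<in> trans A" "num_of \<nu> d = (ps, x, y, q)"
      using mem unfolding set_map ds(2) by (elim imageE) simp
    then obtain qs' B b q' where "(qs', (B, b), q') \<in> trans A" "ps = map \<nu> qs'" "x = mask B"
      by (cases d) auto
    then show ?thesis
      using trans_D[of qs' "(B, b)" q'] concrete_bags_D(1)[of "(B, b)"] mask_less by auto
  qed
  ultimately obtain n where n: "computes_in Sub_Program xs n ?ys"
    "n \<le> 24 * t + 46 + (9 * t + 6 * (2 ^ t) ^ 3 + 12) * (length (map \<nu> qs) + length (map \<nu> fs)) +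
      ((186 * t + 115) * (2 ^ t) ^ 8 + 26) * length (map (num_of \<nu>) ds)"
    using Sub_Program_computes by blast
  have "final A \<subseteq> states A" "finite (states A)" using A by (simp_all add: tree_automaton_def)
  \<comment> \<open>The size of \<open>A\<close> does not count final states separately; they are
    charged to the states.\<close>
  then have "length fs \<le> length qs"
    using qs fs by (metis card_mono distinct_card)
  then have "n \<le> 2 ^ (9 * t + 9) * max 1 (length qs + length ds)"
    using n(2) by (intro running_time_bound) simp_all
  moreover have "length qs + length ds = ta_size A"
    unfolding ta_size_def using qs ds by (metis distinct_card)
  ultimately have "n \<le> 2 ^ (9 * t + 9) * max 1 (ta_size A)" by simp
  then show "\<exists>n ys (SubA :: (nat, bag) ta). computes_in Sub_Program xs n ys \<and>
      n \<le> 2 ^ (9 * t + 9) * max 1 (ta_size A) \<and> represents t ys SubA \<and>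
      tree_automaton (concrete_bags t) SubA \<and>
      lang SubA = {T \<in> Ter (concrete_bags t). \<exists>T' \<in> lang A. sub_decomposition t T T'}"
    using n(1) represents_sub_automaton[OF qs fs ds] tree_automaton_sub_automaton lang_sub_automaton
    by blast
qed

end
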